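(* Let $\mathbb K$ be a field of characteristic zero. For any connected cocommutative bialgebra $\mathcal H$ (in the nonunital framework) the universal idempotent $e$ is equal to the Eulerian idempotent $e^{(1)}$: $$e:=\prod_{n\ge2}(\mathrm{Id}-\omega^{[n]})=\sum_{n\ge1}(-1)^{n+1}\frac{J^{\star n}}{n}=:e^{(1)} .$$
   Context: Nonunital framework: $\mathcal H$ is the augmentation ideal of a classical cocommutative bialgebra, i.e. a nonunital associative algebra $(\mathcal H,\mu)$ with a coassociative cocommutative coproduct $\delta$ (the reduced coproduct, $\delta(x)=\Delta(x)-x\otimes1-1\otimes x$) satisfying the relation equivalent to $\Delta(xy)=\Delta(x)\Delta(y)$, namely, with $\delta(x)=x_{(1)}\otimes x_{(2)}$: $\delta(xy)=x\otimes y+y\otimes x+x_{(1)}\otimes x_{(2)}y+x_{(1)}y\otimes x_{(2)}+xy_{(1)}\otimes y_{(2)}+y_{(1)}\otimes xy_{(2)}+x_{(1)}y_{(1)}\otimes x_{(2)}y_{(2)}$. Let $\delta^{(n)}:\mathcal H\to\mathcal H^{\otimes n}$ be the iterated coproduct ($\delta^{(1)}=\mathrm{Id}$, $\delta^{(2)}=\delta$) and $\mu^{(n)}:\mathcal H^{\otimes n}\to\mathcal H$ the iterated product. $\mathcal H$ is connected if each $x\in\mathcal H$ satisfies $\delta^{(n)}(x)=0$ for all large $n$. Convolution: $f\star g=\mu\circ(f\otimes g)\circ\delta$. $J$ is the identity of $\mathcal H$ (in the unital framework, $J=\mathrm{Id}-uc$ with $u$ the unit and $c$ the counit), so $J^{\star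 n}=\mu^{(n)}\delta^{(n)}$. The Eulerian idempotent is $e^{(1)}=\log^\star(uc+J)=J-\frac{J^{\star2}}2+\frac{J^{\star3}}3-\cdots$. The map $\omega^{[n]}:\mathcal H\to\mathcal H$ is the composite $\mathcal H\xrightarrow{\theta_n}Com^c(n)\otimes_{S_n}\mathcal H^{\otimes n}\xrightarrow{s(n)\otimes\mathrm{Id}}As(n)\otimes_{S_n}\mathcal H^{\otimes n}\xrightarrow{\gamma_n}\mathcal H$, where $\theta_n$ is the $n$-th component of the coalgebra structure (invariants and coinvariants being identified so that $\theta_n(x)$ is $\frac1{n!}$ times the class of $\delta^{(n)}(x)$), $s(n):Com^c(n)=\mathbb K\to As(n)=\mathbb K[S_n]$ is $1\mapsto\frac1{n!}\sum_{\sigma\in S_n}\sigma$, and $\gamma_n$ is the algebra structure; explicitly $\omega^{[n]}=\frac1{n!}\mu^{(n)}\delta^{(n)}$. The product $\prod_{n\ge2}(\mathrm{Id}-\omega^{[n]})=(\mathrm{Id}-\omega^{[2]})(\mathrm{Id}-\omega^{[3]})\cdots$ is well defined since it is finite on each element of a connected $\mathcal H$. *)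

theory Defs
  imports
    Complex_Main
    "HOL-Library.Poly_Mapping"
    "HOL-Combinatorics.Permutations"
begin

section \<open>Free vector spaces and tensor powers\<close>

text \<open>\<^typ>\<open>'w \<Rightarrow>\<^sub>0 'k\<close> is used as the free \<open>'k\<close>-vector space on the basis \<open>'w\<close>.\<close>

definition free_scale :: "'k::field \<Rightarrow> ('w \<Rightarrow>\<^sub>0 'k) \<Rightarrow> 'w \<Rightarrow>\<^sub>0 'k" where
  "free_scale c t = Poly_Mapping.map ((*) c) t"

lemma lookup_free_scale [simp]:
  "Poly_Mapping.lookup (free_scale c t) w = c * Poly_Mapping.lookup t w"
  by (simp add: free_scale_def Poly_Mapping.map.rep_eq when_def)

global_interpretation free: vector_space "free_scale :: 'k::field \<Rightarrow> ('w \<Rightarrow>\<^sub>0 'k) \<Rightarrow> _"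
  by unfold_locales
    (auto intro!: poly_mapping_eqI simp: lookup_add algebra_simps)

text \<open>The linear extension of a map \<open>f\<close> defined on a basis; \<open>sc\<close> is the scalar multiplication
  of the target.\<close>

definition lin_ext ::
    "('k::field \<Rightarrow> 'v \<Rightarrow> 'v) \<Rightarrow> ('w \<Rightarrow> 'v) \<Rightarrow> ('w \<Rightarrow>\<^sub>0 'k) \<Rightarrow> 'v::comm_monoid_add" where
  "lin_ext sc f t = (\<Sum>w\<in>Poly_Mapping.keys t. sc (Poly_Mapping.lookup t w) (f w))"

text \<open>
  Tensors over a vector space \<open>H\<close> (type \<open>'a\<close> with scalar multiplication \<open>scale\<close>) are
  represented by formal linear combinations of words: the word \<open>[x\<^sub>1,\<dots>,x\<^sub>n]\<close> stands for
  \<open>x\<^sub>1 \<otimes> \<dots> \<otimes> x\<^sub>n\<close>.  The tensor power \<open>H\<^sup>\<otimes>\<^sup>n\<close> is the quotient of the space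
  \<open>words n\<close> by the subspace generated by the multilinearity relations; equality in this quotient
  is the relation \<open>tensor_eq\<close>.  The relations are homogeneous in the length of words, so
  words of different lengths do not interact.
\<close>

definition words :: "nat \<Rightarrow> ('a list \<Rightarrow>\<^sub>0 'k::zero) set" where
  "words n = {t. \<forall>w\<in>Poly_Mapping.keys t. length w = n}"

definition pure :: "'a list \<Rightarrow> ('a list \<Rightarrow>\<^sub>0 'k::field)" where
  "pure w = Poly_Mapping.single w 1"

definition multilinear_rels ::
    "('k::field \<Rightarrow> 'a \<Rightarrow> 'a) \<Rightarrow> ('a::ab_group_add list \<Rightarrow>\<^sub>0 'k) set" where
  "multilinear_rels scale =
     {pure (u @ [a + b] @ v) - pure (u @ [a] @ v) - pure (u @ [b] @ v) | u v a b. True} \<union>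
     {pure (u @ [scale c a] @ v) - free_scale c (pure (u @ [a] @ v)) | u v a c. True}"

definition tensor_eq ::
    "('k::field \<Rightarrow> 'a \<Rightarrow> 'a) \<Rightarrow> ('a::ab_group_add list \<Rightarrow>\<^sub>0 'k) \<Rightarrow> ('a list \<Rightarrow>\<^sub>0 'k) \<Rightarrow> bool" where
  "tensor_eq scale s t \<longleftrightarrow> s - t \<in> free.span (multilinear_rels scale)"

definition tensor_append ::
    "('a list \<Rightarrow>\<^sub>0 'k::field) \<Rightarrow> ('a list \<Rightarrow>\<^sub>0 'k) \<Rightarrow> 'a list \<Rightarrow>\<^sub>0 'k" where
  "tensor_append s t = lin_ext free_scale (\<lambda>u. lin_ext free_scale (\<lambda>v. pure (u @ v)) t) s"


section \<open>Nonunital cocommutative bialgebras\<close>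

text \<open>
  The class \<^class>\<open>ring\<close> of associative rings without unit provides the product of \<open>H\<close>.  The
  coproduct \<open>\<delta> : H \<rightarrow> H \<otimes> H\<close> is given by \<open>delta\<close>, which picks for every \<open>x\<close> a formal sum
  representing \<open>\<delta>(x)\<close>, so all its axioms are stated up to \<open>tensor_eq\<close>.  In \<open>delta_mult\<close> each
  \<open>lin_ext\<close> is one Sweedler summation, with \<open>w ! 0\<close>, \<open>w ! 1\<close> the two components.
\<close>

locale nonunital_bialgebra = vector_space scale
  for scale :: "'k::field_char_0 \<Rightarrow> 'a::ring \<Rightarrow> 'a" +
  fixes delta :: "'a \<Rightarrow> 'a list \<Rightarrow>\<^sub>0 'k"
  assumes scale_mult_left: "scale c x * y = scale c (x * y)"
    and scale_mult_right: "x * scale c y = scale c (x * y)"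
    and delta_words: "delta x \<in> words 2"
    and delta_add: "tensor_eq scale (delta (x + y)) (delta x + delta y)"
    and delta_scale: "tensor_eq scale (delta (scale c x)) (free_scale c (delta x))"
    and coassociative: "tensor_eq scale
      (lin_ext free_scale (\<lambda>w. tensor_append (delta (w ! 0)) (pure [w ! 1])) (delta x))
      (lin_ext free_scale (\<lambda>w. tensor_append (pure [w ! 0]) (delta (w ! 1))) (delta x))"
    and delta_mult: "tensor_eq scale (delta (x * y))
      (pure [x, y] + pure [y, x]
       + lin_ext free_scale (\<lambda>w. pure [w ! 0, w ! 1 * y]) (delta x)
       + lin_ext free_scale (\<lambda>w. pure [w ! 0 * y, w ! 1]) (delta x)
       + lin_ext free_scale (\<lambda>w. pure [x * w ! 0, w ! 1]) (delta y)
       + lin_ext free_scale (\<lambda>w. pure [w ! 0, x * w ! 1]) (delta y)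
       + lin_ext free_scale (\<lambda>w. lin_ext free_scale
           (\<lambda>v. pure [w ! 0 * v ! 0, w ! 1 * v ! 1]) (delta y)) (delta x))"

locale cocommutative_bialgebra = nonunital_bialgebra +
  assumes cocommutative:
    "tensor_eq scale (lin_ext free_scale (\<lambda>w. pure [w ! 1, w ! 0]) (delta x)) (delta x)"

text \<open>\<open>\<delta>\<^sup>(\<^sup>n\<^sup>)\<close> and \<open>\<mu>\<^sup>(\<^sup>n\<^sup>)\<close> are meant for \<open>n \<ge> 1\<close>; the values at \<open>0\<close> and at the
  empty word are irrelevant.\<close>

fun iter_delta :: "('a \<Rightarrow> 'a list \<Rightarrow>\<^sub>0 'k::field) \<Rightarrow> nat \<Rightarrow> 'a \<Rightarrow> 'a list \<Rightarrow>\<^sub>0 'k" where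
  "iter_delta delta 0 x = 0"
| "iter_delta delta (Suc 0) x = pure [x]"
| "iter_delta delta (Suc (Suc n)) x =
     lin_ext free_scale (\<lambda>w. tensor_append (iter_delta delta (Suc n) (w ! 0)) (pure [w ! 1])) (delta x)"

fun iter_mult :: "'a::ring list \<Rightarrow> 'a" where
  "iter_mult [] = 0"
| "iter_mult [x] = x"
| "iter_mult (x # y # ys) = x * iter_mult (y # ys)"

locale connected_cocommutative_bialgebra = cocommutative_bialgebra +
  assumes connected: "\<exists>N. \<forall>n\<ge>N. tensor_eq scale (iter_delta delta n x) 0"


section \<open>The Eulerian idempotent\<close>

definition convolution ::
    "('k::field \<Rightarrow> 'a \<Rightarrow> 'a) \<Rightarrow> ('a \<Rightarrow> 'a list \<Rightarrow>\<^sub>0 'k) \<Rightarrow> ('a \<Rightarrow> 'a) \<Rightarrow> ('a \<Rightarrow> 'a) \<Rightarrow> 'a \<Rightarrow> 'a::ring" where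
  "convolution scale delta f g x =
     lin_ext scale iter_mult (lin_ext free_scale (\<lambda>w. pure [f (w ! 0), g (w ! 1)]) (delta x))"

text \<open>\<open>J\<^sup>\<star>\<^sup>n\<close> for \<open>n \<ge> 1\<close>, where \<open>J\<close> is the identity of \<open>H\<close>.  (In the unital framework
  \<open>J\<^sup>\<star>\<^sup>0\<close> is \<open>uc\<close>, which vanishes on \<open>H\<close>.)\<close>

fun J_power ::
    "('k::field \<Rightarrow> 'a \<Rightarrow> 'a) \<Rightarrow> ('a \<Rightarrow> 'a list \<Rightarrow>\<^sub>0 'k) \<Rightarrow> nat \<Rightarrow> 'a \<Rightarrow> 'a::ring" where
  "J_power scale delta 0 = (\<lambda>x. 0)"
| "J_power scale delta (Suc 0) = id"
| "J_power scale delta (Suc (Suc n)) = convolution scale delta (J_power scale delta (Suc n)) id"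

text \<open>The sum of a series, or the value of an infinite product, that is finite on each element: the
  value at which the sequence of partial results becomes stationary.\<close>

definition stable_value :: "(nat \<Rightarrow> 'b) \<Rightarrow> 'b" where
  "stable_value X = (THE y. \<forall>\<^sub>F n in sequentially. X n = y)"

lemma stable_value_eqI:
  assumes "\<forall>\<^sub>F n in sequentially. X n = y"
  shows "stable_value X = y"
  unfolding stable_value_def
proof (rule the_equality)
  fix z assume "\<forall>\<^sub>F n in sequentially. X n = z"
  with assms have "\<forall>\<^sub>F n in sequentially. z = y" by eventually_elim simp
  thus "z = y" by simp
qed (fact assms)

definition eulerian_partial_sum ::
    "('k::field_char_0 \<Rightarrow> 'a \<Rightarrow> 'a) \<Rightarrow> ('a \<Rightarrow> 'a list \<Rightarrow>\<^sub>0 'k) \<Rightarrow> nat \<Rightarrow> 'a \<Rightarrow> 'a::ring" where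
  "eulerian_partial_sum scale delta N x =
     (\<Sum>n=1..N. scale ((- 1) ^ (n + 1) / of_nat n) (J_power scale delta n x))"

definition eulerian_idempotent ::
    "('k::field_char_0 \<Rightarrow> 'a \<Rightarrow> 'a) \<Rightarrow> ('a \<Rightarrow> 'a list \<Rightarrow>\<^sub>0 'k) \<Rightarrow> 'a \<Rightarrow> 'a::ring" where
  "eulerian_idempotent scale delta x = stable_value (\<lambda>N. eulerian_partial_sum scale delta N x)"


section \<open>The universal idempotent\<close>

text \<open>\<open>\<theta>\<^sub>n(x)\<close> is represented in \<open>H\<^sup>\<otimes>\<^sup>n\<close>; its class lies in the coinvariants
  \<open>Com\<^sup>c(n) \<otimes>\<^bsub>S\<^sub>n\<^esub> H\<^sup>\<otimes>\<^sup>n\<close>.\<close>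

definition theta ::
    "('a \<Rightarrow> 'a list \<Rightarrow>\<^sub>0 'k::field_char_0) \<Rightarrow> nat \<Rightarrow> 'a \<Rightarrow> 'a list \<Rightarrow>\<^sub>0 'k" where
  "theta delta n x = free_scale (1 / fact n) (iter_delta delta n x)"

text \<open>The map \<open>s(n) \<otimes> Id\<close>; the basis element \<open>(\<sigma>, w)\<close> stands for \<open>\<sigma> \<otimes> w\<close> in
  \<open>As(n) \<otimes> H\<^sup>\<otimes>\<^sup>n\<close>.\<close>

definition section_map ::
    "nat \<Rightarrow> ('a list \<Rightarrow>\<^sub>0 'k::field_char_0) \<Rightarrow> ((nat \<Rightarrow> nat) \<times> 'a list) \<Rightarrow>\<^sub>0 'k" where
  "section_map n = lin_ext free_scale
     (\<lambda>w. free_scale (1 / fact n) (\<Sum>\<sigma> | \<sigma> permutes {..<n}. Poly_Mapping.single (\<sigma>, w) 1))"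

text \<open>\<open>\<gamma>\<^sub>n\<close> multiplies the letters of a word in the order prescribed by the permutation.  Whether
  this order is read off from \<open>\<sigma>\<close> or \<open>\<sigma>\<^sup>-\<^sup>1\<close> is immaterial here, as \<open>section_map\<close> sums over
  all permutations.\<close>

definition gamma ::
    "('k::field_char_0 \<Rightarrow> 'a \<Rightarrow> 'a) \<Rightarrow> (((nat \<Rightarrow> nat) \<times> 'a list) \<Rightarrow>\<^sub>0 'k) \<Rightarrow> 'a::ring" where
  "gamma scale = lin_ext scale (\<lambda>(\<sigma>, w). iter_mult (permute_list \<sigma> w))"

definition omega ::
    "('k::field_char_0 \<Rightarrow> 'a \<Rightarrow> 'a) \<Rightarrow> ('a \<Rightarrow> 'a list \<Rightarrow>\<^sub>0 'k) \<Rightarrow> nat \<Rightarrow> 'a \<Rightarrow> 'a::ring" where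
  "omega scale delta n x = gamma scale (section_map n (theta delta n x))"

text \<open>The composite \<open>(Id - \<omega>\<^sup>[\<^sup>2\<^sup>]) \<circ> (Id - \<omega>\<^sup>[\<^sup>3\<^sup>]) \<circ> \<dots>\<close> of the first \<open>N\<close> factors.\<close>

primrec universal_partial_product ::
    "('k::field_char_0 \<Rightarrow> 'a \<Rightarrow> 'a) \<Rightarrow> ('a \<Rightarrow> 'a list \<Rightarrow>\<^sub>0 'k) \<Rightarrow> nat \<Rightarrow> 'a \<Rightarrow> 'a::ring" where
  "universal_partial_product scale delta 0 = id"
| "universal_partial_product scale delta (Suc N) =
     universal_partial_product scale delta N \<circ> (\<lambda>x. x - omega scale delta (N + 2) x)"

definition universal_idempotent ::
    "('k::field_char_0 \<Rightarrow> 'a \<Rightarrow> 'a) \<Rightarrow> ('a \<Rightarrow> 'a list \<Rightarrow>\<^sub>0 'k) \<Rightarrow> 'a \<Rightarrow> 'a::ring" where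
  "universal_idempotent scale delta x =
     stable_value (\<lambda>N. universal_partial_product scale delta N x)"


section \<open>The two idempotents are well defined\<close>

lemma lin_ext_superset:
  assumes "vector_space sc" "finite A" "Poly_Mapping.keys t \<subseteq> A"
  shows "lin_ext sc f t = (\<Sum>w\<in>A. sc (Poly_Mapping.lookup t w) (f w))"
proof -
  interpret vector_space sc by fact
  show ?thesis unfolding lin_ext_def
    by (rule sum.mono_neutral_left) (use assms in \<open>auto simp: in_keys_iff\<close>)
qed

lemma module_hom_lin_ext:
  assumes "vector_space sc"
  shows "module_hom free_scale sc (lin_ext sc f)"
proof -
  interpret V: vector_space sc by fact
  have add: "lin_ext sc f (s + t) = lin_ext sc f s + lin_ext sc f t" for s t
  proof -
    let ?A = "Poly_Mapping.keys s \<union> Poly_Mapping.keys t"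
    have "Poly_Mapping.keys (s + t) \<subseteq> ?A" by (rule Poly_Mapping.keys_add)
    thus ?thesis
      by (simp add: lin_ext_superset[OF assms, of ?A] lookup_add V.scale_left_distrib sum.distrib)
  qed
  have scl: "lin_ext sc f (free_scale c t) = sc c (lin_ext sc f t)" for c t
  proof -
    have "Poly_Mapping.keys (free_scale c t) \<subseteq> Poly_Mapping.keys t"
      by (auto simp: in_keys_iff)
    thus ?thesis
      by (simp add: lin_ext_superset[OF assms, of "Poly_Mapping.keys t"] V.scale_sum_right)
  qed
  show ?thesis
    by unfold_locales (auto simp: add scl)
qed

lemma lin_ext_single:
  assumes "vector_space sc"
  shows "lin_ext sc f (Poly_Mapping.single w c) = sc c (f w)"
  using lin_ext_superset[OF assms, of "{w}" "Poly_Mapping.single w c"] by simp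

lemma lin_ext_pure:
  assumes "vector_space sc"
  shows "lin_ext sc f (pure w) = f w"
proof -
  interpret vector_space sc by fact
  show ?thesis by (simp add: pure_def lin_ext_single[OF assms])
qed

lemma lin_ext_lin_ext:
  assumes "vector_space sc"
  shows "lin_ext sc f (lin_ext free_scale g t) = lin_ext sc (\<lambda>w. lin_ext sc f (g w)) t"
proof -
  interpret module_hom free_scale sc "lin_ext sc f"
    by (rule module_hom_lin_ext[OF assms])
  show ?thesis
    unfolding lin_ext_def[of free_scale] lin_ext_def[of sc _ t] by (simp add: sum scale)
qed

lemma lin_ext_cong:
  "(\<And>w. w \<in> Poly_Mapping.keys t \<Longrightarrow> f w = g w) \<Longrightarrow> lin_ext sc f t = lin_ext sc g t"
  by (simp add: lin_ext_def)

lemma words_lin_ext: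
  assumes "\<And>w. w \<in> Poly_Mapping.keys t \<Longrightarrow> g w \<in> words n"
  shows "lin_ext free_scale g t \<in> words n"
proof -
  have "Poly_Mapping.keys (lin_ext free_scale g t)
      \<subseteq> (\<Union>w\<in>Poly_Mapping.keys t. Poly_Mapping.keys (free_scale (Poly_Mapping.lookup t w) (g w)))"
    unfolding lin_ext_def by (rule Poly_Mapping.keys_sum)
  also have "\<dots> \<subseteq> (\<Union>w\<in>Poly_Mapping.keys t. Poly_Mapping.keys (g w))"
    by (auto simp: in_keys_iff)
  finally show ?thesis using assms by (force simp: words_def)
qed

lemma words_pure: "length w = n \<Longrightarrow> pure w \<in> words n"
  by (simp add: words_def pure_def)

lemma words_tensor_append:
  "s \<in> words m \<Longrightarrow> t \<in> words n \<Longrightarrow> tensor_append s t \<in> words (m + n)"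
  unfolding tensor_append_def
  by (intro words_lin_ext words_pure) (auto simp: words_def)

lemma iter_mult_snoc: "u \<noteq> [] \<Longrightarrow> iter_mult (u @ [b]) = iter_mult u * b"
  by (induction u rule: iter_mult.induct) (auto simp: mult.assoc)

context nonunital_bialgebra
begin

lemma vs: "vector_space scale" by unfold_locales

lemma iter_mult_add:
  "iter_mult (u @ [a + b] @ v) = iter_mult (u @ [a] @ v) + iter_mult (u @ [b] @ v)"
proof (induction u)
  case Nil show ?case by (cases v) (auto simp: distrib_right)
next
  case (Cons x u) thus ?case
    by (cases u) (cases v; auto simp: distrib_left distrib_right)+
qed

lemma iter_mult_scale:
  "iter_mult (u @ [scale c a] @ v) = scale c (iter_mult (u @ [a] @ v))"
proof (induction u)
  case Nil show ?case by (cases v) (auto simp: scale_mult_left)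
next
  case (Cons x u) thus ?case
    by (cases u) (cases v; auto simp: scale_mult_left scale_mult_right)+
qed

lemma iter_delta_words: "iter_delta delta n x \<in> words n"
proof (induction n arbitrary: x rule: nat_less_induct)
  case IH: (1 n)
  consider "n = 0" | "n = Suc 0" | m where "n = Suc (Suc m)" by (metis not0_implies_Suc)
  thus ?case
  proof cases
    case (3 m)
    have "tensor_append (iter_delta delta (Suc m) a) (pure [b]) \<in> words (Suc m + 1)" for a b
      using IH 3 by (intro words_tensor_append words_pure) auto
    thus ?thesis using 3 by (auto intro!: words_lin_ext)
  qed (auto simp: words_def pure_def)
qed

text \<open>\<open>J\<^sup>\<star>\<^sup>n = \<mu>\<^sup>(\<^sup>n\<^sup>) \<circ> \<delta>\<^sup>(\<^sup>n\<^sup>)\<close>\<close>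

lemma J_power_eq: "J_power scale delta n x = lin_ext scale iter_mult (iter_delta delta n x)"
proof (induction n arbitrary: x rule: nat_less_induct)
  case IH: (1 n)
  consider "n = 0" | "n = Suc 0" | m where "n = Suc (Suc m)" by (metis not0_implies_Suc)
  thus ?case
  proof cases
    case 1
    thus ?thesis by (auto simp: lin_ext_def)
  next
    case 2
    thus ?thesis by (auto simp: lin_ext_pure[OF vs])
  next
    case (3 m)
    have "lin_ext scale iter_mult (tensor_append (iter_delta delta (Suc m) a) (pure [b]))
        = J_power scale delta (Suc m) a * b" for a b
    proof -
      let ?d = "iter_delta delta (Suc m) a"
      have "lin_ext scale iter_mult (tensor_append ?d (pure [b]))
          = lin_ext scale (\<lambda>u. iter_mult (u @ [b])) ?d"
        by (simp add: tensor_append_def lin_ext_lin_ext[OF vs] lin_ext_pure[OF vs])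
      also have "\<dots> = lin_ext scale (\<lambda>u. iter_mult u * b) ?d"
        using iter_delta_words[of "Suc m" a]
        by (intro lin_ext_cong iter_mult_snoc) (auto simp: words_def)
      also have "\<dots> = lin_ext scale iter_mult ?d * b"
        by (simp add: lin_ext_def sum_distrib_right scale_mult_left)
      also have "\<dots> = J_power scale delta (Suc m) a * b"
        using IH 3 by simp
      finally show ?thesis .
    qed
    thus ?thesis using 3
      by (auto simp: convolution_def lin_ext_lin_ext[OF vs] lin_ext_pure[OF vs])
  qed
qed

lemma lin_ext_multilinear_eq_0:
  assumes "t \<in> words n" "tensor_eq scale t 0"
    and add: "\<And>u v a b. length u + length v + 1 = n \<Longrightarrow>
      f (u @ [a + b] @ v) = f (u @ [a] @ v) + f (u @ [b] @ v)"
    and scl: "\<And>u v a c. length u + length v + 1 = n \<Longrightarrow>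
      f (u @ [scale c a] @ v) = scale c (f (u @ [a] @ v))"
  shows "lin_ext scale f t = 0"
proof -
  define g where "g w = (if length w = n then f w else 0)" for w
  interpret g: module_hom free_scale scale "lin_ext scale g"
    by (rule module_hom_lin_ext[OF vs])
  have "lin_ext scale g r = 0" if "r \<in> multilinear_rels scale" for r
    using that unfolding multilinear_rels_def
    by (auto simp: g.diff g.scale lin_ext_pure[OF vs] g_def add[simplified] scl[simplified])
  hence "lin_ext scale g t = 0"
    using assms(2) g.eq_0_on_span unfolding tensor_eq_def by (metis diff_zero)
  moreover have "lin_ext scale g t = lin_ext scale f t"
    using assms(1) by (intro lin_ext_cong) (auto simp: g_def words_def)
  ultimately show ?thesis by simp
qed

lemma J_power_eq_0:
  assumes "tensor_eq scale (iter_delta delta n x) 0"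
  shows "J_power scale delta n x = 0"
  unfolding J_power_eq
  by (rule lin_ext_multilinear_eq_0[OF iter_delta_words assms iter_mult_add iter_mult_scale])

lemma permute_list_slot:
  fixes u v :: "'a list"
  assumes "\<sigma> permutes {..<length u + length v + 1}"
  obtains u' v' where "\<And>a. permute_list \<sigma> (u @ [a] @ v) = u' @ [a] @ v'"
proof -
  let ?n = "length u + length v + 1"
  obtain k where k: "k < ?n" "\<sigma> k = length u"
  proof -
    have "length u \<in> \<sigma> ` {..<?n}" by (simp only: permutes_image[OF assms]) simp
    thus ?thesis using that by auto
  qed
  have other: "(u @ [a] @ v) ! \<sigma> i = (u @ [b] @ v) ! \<sigma> i" if "i \<noteq> k" for a b i
  proof -
    have "\<sigma> i \<noteq> length u" using that k permutes_inj[OF assms] by (metis injD)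
    thus ?thesis by (auto simp: nth_append nth_Cons')
  qed
  let ?p = "\<lambda>a. permute_list \<sigma> (u @ [a] @ v)"
  have nth: "?p a ! i = (u @ [a] @ v) ! \<sigma> i" if "i < ?n" for a i
    using that by (simp add: permute_list_def del: upt_Suc)
  have len: "length (?p a) = ?n" for a by simp
  have "?p a = take k (?p 0) @ [a] @ drop (Suc k) (?p 0)" for a
  proof -
    have "?p a = take k (?p a) @ [?p a ! k] @ drop (Suc k) (?p a)"
      using k(1) len[of a] by (metis append_Cons append_Nil id_take_nth_drop)
    moreover have "?p a ! k = a" using nth[OF k(1)] k(2) by simp
    moreover have "take k (?p a) = take k (?p 0)"
      by (rule nth_equalityI) (use k(1) nth other[of _ a 0] len in auto)
    moreover have "drop (Suc k) (?p a) = drop (Suc k) (?p 0)"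
      by (rule nth_equalityI) (use k(1) nth other[of _ a 0] len in auto)
    ultimately show ?thesis by metis
  qed
  thus thesis by (rule that)
qed

lemma omega_eq:
  "omega scale delta n x =
     lin_ext scale (\<lambda>w. scale (1 / fact n)
       (\<Sum>\<sigma> | \<sigma> permutes {..<n}. iter_mult (permute_list \<sigma> w))) (theta delta n x)"
proof -
  interpret G: module_hom free_scale scale
    "lin_ext scale (\<lambda>(\<sigma>, w). iter_mult (permute_list \<sigma> w))"
    by (rule module_hom_lin_ext[OF vs])
  show ?thesis
    unfolding omega_def gamma_def section_map_def lin_ext_lin_ext[OF vs]
    by (simp add: G.scale G.sum lin_ext_single[OF vs])
qed

lemma omega_eq_0:
  assumes "tensor_eq scale (iter_delta delta n x) 0"
  shows "omega scale delta n x = 0"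
  unfolding omega_eq theta_def
    module_hom.scale[OF module_hom_lin_ext[OF vs]]
proof (rule scale_eq_0_iff[THEN iffD2], rule disjI2,
    rule lin_ext_multilinear_eq_0[OF iter_delta_words assms])
  fix u v :: "'a list" and a b :: 'a assume n: "length u + length v + 1 = n"
  have "iter_mult (permute_list \<sigma> (u @ [a + b] @ v))
      = iter_mult (permute_list \<sigma> (u @ [a] @ v)) + iter_mult (permute_list \<sigma> (u @ [b] @ v))"
    if p: "\<sigma> permutes {..<n}" for \<sigma>
  proof -
    obtain u' v' where "\<And>a. permute_list \<sigma> (u @ [a] @ v) = u' @ [a] @ v'"
      by (rule permute_list_slot[of \<sigma> u v]) (use p n in simp_all)
    thus ?thesis by (simp only: iter_mult_add)
  qed
  thus "scale (1 / fact n) (\<Sum>\<sigma> | \<sigma> permutes {..<n}. iter_mult (permute_list \<sigma> (u @ [a + b] @ v)))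
     = scale (1 / fact n) (\<Sum>\<sigma> | \<sigma> permutes {..<n}. iter_mult (permute_list \<sigma> (u @ [a] @ v)))
     + scale (1 / fact n) (\<Sum>\<sigma> | \<sigma> permutes {..<n}. iter_mult (permute_list \<sigma> (u @ [b] @ v)))"
    by (simp add: sum.distrib scale_right_distrib)
next
  fix u v :: "'a list" and a :: 'a and c assume n: "length u + length v + 1 = n"
  have "iter_mult (permute_list \<sigma> (u @ [scale c a] @ v))
      = scale c (iter_mult (permute_list \<sigma> (u @ [a] @ v)))"
    if p: "\<sigma> permutes {..<n}" for \<sigma>
  proof -
    obtain u' v' where "\<And>a. permute_list \<sigma> (u @ [a] @ v) = u' @ [a] @ v'"
      by (rule permute_list_slot[of \<sigma> u v]) (use p n in simp_all)
    thus ?thesis by (simp only: iter_mult_scale)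
  qed
  hence "(\<Sum>\<sigma> | \<sigma> permutes {..<n}. iter_mult (permute_list \<sigma> (u @ [scale c a] @ v)))
      = scale c (\<Sum>\<sigma> | \<sigma> permutes {..<n}. iter_mult (permute_list \<sigma> (u @ [a] @ v)))"
    unfolding scale_sum_right by (intro sum.cong) auto
  thus "scale (1 / fact n) (\<Sum>\<sigma> | \<sigma> permutes {..<n}. iter_mult (permute_list \<sigma> (u @ [scale c a] @ v)))
     = scale c (scale (1 / fact n) (\<Sum>\<sigma> | \<sigma> permutes {..<n}. iter_mult (permute_list \<sigma> (u @ [a] @ v))))"
    by (simp only: scale_left_commute)
qed

end

lemma eventually_const_from_Suc:
  assumes "\<And>N. N \<ge> M \<Longrightarrow> X (Suc N) = X N"
  shows "\<forall>\<^sub>F N in sequentially. X N = X M"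
proof -
  have "X N = X M" if "N \<ge> M" for N
    using that by (induction N rule: dec_induct) (auto simp: assms)
  thus ?thesis unfolding eventually_sequentially by blast
qed

context connected_cocommutative_bialgebra
begin

lemma eulerian_idempotent_well_defined:
  "\<forall>\<^sub>F N in sequentially. eulerian_partial_sum scale delta N x = eulerian_idempotent scale delta x"
proof -
  obtain M where M: "\<And>n. n \<ge> M \<Longrightarrow> tensor_eq scale (iter_delta delta n x) 0"
    using connected by blast
  have "\<forall>\<^sub>F N in sequentially.
      eulerian_partial_sum scale delta N x = eulerian_partial_sum scale delta M x"
    by (rule eventually_const_from_Suc)
      (simp add: eulerian_partial_sum_def J_power_eq_0 M del: J_power.simps)
  thus ?thesis unfolding eulerian_idempotent_def by (simp add: stable_value_eqI)
qed

lemma universal_idempotent_well_defined: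
  "\<forall>\<^sub>F N in sequentially.
     universal_partial_product scale delta N x = universal_idempotent scale delta x"
proof -
  obtain M where M: "\<And>n. n \<ge> M \<Longrightarrow> tensor_eq scale (iter_delta delta n x) 0"
    using connected by blast
  have "\<forall>\<^sub>F N in sequentially.
      universal_partial_product scale delta N x = universal_partial_product scale delta M x"
    by (rule eventually_const_from_Suc) (simp add: omega_eq_0 M del: iter_delta.simps)
  thus ?thesis unfolding universal_idempotent_def by (simp add: stable_value_eqI)
qed

end

end

theory Submission
  imports Defs "HOL-Combinatorics.Stirling"
begin

text \<open>
  Cocommutativity makes the Adams operations \<open>\<Psi>\<^sup>a = (uc + J)\<^sup>\<star>\<^sup>a\<close> coalgebra maps, whence
  \<open>\<Psi>\<^sup>a \<circ> \<Psi>\<^sup>b = \<Psi>\<^sup>a\<^sup>b\<close>.  By connectedness \<open>\<Psi>\<^sup>a(x) = \<Sum>\<^sub>n (a choose n) J\<^sup>\<star>\<^sup>n(x)\<close> is a polynomial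
  \<open>\<Sum>\<^sub>i a\<^sup>i e\<^sub>i(x)\<close> in \<open>a\<close>, so \<open>x = \<Psi>\<^sup>1(x)\<close> is the sum of the eigenvectors \<open>e\<^sub>i(x)\<close>, on which \<open>\<Psi>\<^sup>a\<close> acts
  as \<open>a\<^sup>i\<close>; the linear coefficient \<open>e\<^sub>1(x)\<close> is the Eulerian idempotent.  Inverting the binomial
  transform, \<open>\<omega>\<^sup>[\<^sup>n\<^sup>] = J\<^sup>\<star>\<^sup>n/n!\<close> acts on \<open>e\<^sub>i(x)\<close> as the Stirling number \<open>S(i,n)\<close>.  As \<open>S(i,i) = 1\<close>, the
  factor \<open>Id - \<omega>\<^sup>[\<^sup>i\<^sup>]\<close> kills \<open>e\<^sub>i(x)\<close> for \<open>i \<ge> 2\<close>, while \<open>S(1,n) = 0\<close> for \<open>n \<ge> 2\<close> means that every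
  factor fixes \<open>e\<^sub>1(x)\<close>.
\<close>

section \<open>Multilinear functionals on tensors\<close>

context nonunital_bialgebra
begin

definition lin :: "('a \<Rightarrow> 'a) \<Rightarrow> bool" where
  "lin f \<longleftrightarrow> (\<forall>x y. f (x + y) = f x + f y) \<and> (\<forall>c x. f (scale c x) = scale c (f x))"

definition bilin :: "('a \<Rightarrow> 'a \<Rightarrow> 'a) \<Rightarrow> bool" where
  "bilin \<beta> \<longleftrightarrow> (\<forall>a. lin (\<beta> a)) \<and> (\<forall>b. lin (\<lambda>a. \<beta> a b))"

text \<open>Only words of length \<open>n\<close> are constrained, so \<open>F\<close> stands for a
  linear map from the \<open>n\<close>-th tensor power to H.\<close>

definition multilin :: "nat \<Rightarrow> ('a list \<Rightarrow> 'a) \<Rightarrow> bool" where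
  "multilin n F \<longleftrightarrow> (\<forall>u v. length u + length v + 1 = n \<longrightarrow> lin (\<lambda>a. F (u @ [a] @ v)))"

lemma linI:
  "(\<And>x y. f (x + y) = f x + f y) \<Longrightarrow> (\<And>c x. f (scale c x) = scale c (f x)) \<Longrightarrow> lin f"
  by (simp add: lin_def)

lemma lin_add: "lin f \<Longrightarrow> f (x + y) = f x + f y"
  and lin_scale: "lin f \<Longrightarrow> f (scale c x) = scale c (f x)"
  by (simp_all add: lin_def)

lemma lin_zero: "lin f \<Longrightarrow> f 0 = 0"
  using lin_scale[of f 0 0] by simp

lemma lin_sum: "lin f \<Longrightarrow> f (sum g A) = (\<Sum>i\<in>A. f (g i))"
  by (induction A rule: infinite_finite_induct) (auto simp: lin_zero lin_add)

lemma lin_comp: "lin f \<Longrightarrow> lin g \<Longrightarrow> lin (\<lambda>x. f (g x))"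
  by (simp add: lin_def)

lemma bilinI: "(\<And>a. lin (\<beta> a)) \<Longrightarrow> (\<And>b. lin (\<lambda>a. \<beta> a b)) \<Longrightarrow> bilin \<beta>"
  by (simp add: bilin_def)

lemma bilinD: "bilin \<beta> \<Longrightarrow> lin (\<beta> a)" "bilin \<beta> \<Longrightarrow> lin (\<lambda>a. \<beta> a b)"
  by (simp_all add: bilin_def)

lemma bilin_comp:
  "bilin \<beta> \<Longrightarrow> lin f \<Longrightarrow> lin g \<Longrightarrow> bilin (\<lambda>a b. \<beta> (f a) (g b))"
  by (simp add: bilin_def lin_def)

lemma bilin_mult: "bilin (*)"
  by (simp add: bilin_def lin_def distrib_left distrib_right scale_mult_left scale_mult_right)

lemma multilin_lin:
  "multilin n F \<Longrightarrow> length u + length v + 1 = n \<Longrightarrow> lin (\<lambda>a. F (u @ [a] @ v))"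
  by (simp add: multilin_def)

lemma multilin_snoc: "multilin (Suc n) F \<Longrightarrow> multilin n (\<lambda>u. F (u @ [b]))"
  unfolding multilin_def
proof (intro allI impI)
  fix u v :: "'a list"
  assume *: "\<forall>u v. length u + length v + 1 = Suc n \<longrightarrow> lin (\<lambda>a. F (u @ [a] @ v))"
    "length u + length v + 1 = n"
  from *(1)[rule_format, of u "v @ [b]"] *(2) show "lin (\<lambda>a. F ((u @ [a] @ v) @ [b]))" by simp
qed

lemma multilin_iter_mult: "multilin n iter_mult"
  by (auto simp: multilin_def lin_def iter_mult_add[simplified] iter_mult_scale[simplified])

lemma module_hom_lin_ext_scale: "module_hom free_scale scale (lin_ext scale f)"
  by (rule module_hom_lin_ext[OF vs])

lemmas lin_ext_plus = module_hom.add[OF module_hom_lin_ext_scale]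
  and lin_ext_free_scale = module_hom.scale[OF module_hom_lin_ext_scale]
  and lin_ext_diff = module_hom.diff[OF module_hom_lin_ext_scale]

text \<open>A multilinear \<open>F\<close> kills the multilinearity relations. This turns the
  axioms, which hold up to \<open>tensor_eq\<close>, into equations in H.\<close>

lemma lin_ext_tensor_eq:
  assumes "tensor_eq scale s t" "s \<in> words n" "t \<in> words n" "multilin n F"
  shows "lin_ext scale F s = lin_ext scale F t"
proof -
  have "s - t \<in> words n"
    using assms(2,3) keys_diff[of s t] by (auto simp: words_def)
  moreover have "tensor_eq scale (s - t) 0"
    using assms(1) by (simp add: tensor_eq_def)
  ultimately have "lin_ext scale F (s - t) = 0"
    by (rule lin_ext_multilinear_eq_0)
      (use multilin_lin[OF assms(4)] in \<open>simp_all only: lin_def\<close>)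
  thus ?thesis by (simp add: lin_ext_diff)
qed

lemma words_add: "s \<in> words n \<Longrightarrow> t \<in> words n \<Longrightarrow> s + t \<in> words n"
  using Poly_Mapping.keys_add[of s t] by (auto simp: words_def)

lemma words_scale: "s \<in> words n \<Longrightarrow> free_scale c s \<in> words n"
  by (auto simp: words_def in_keys_iff)

section \<open>Sweedler calculus\<close>

text \<open>Sweedler's sum of \<beta>(x_(1), x_(2)). When \<beta> is bilinear, it is independent of
  the formal sum chosen to represent the coproduct.\<close>

definition sweedler :: "('a \<Rightarrow> 'a \<Rightarrow> 'a) \<Rightarrow> 'a \<Rightarrow> 'a" where
  "sweedler \<beta> x = lin_ext scale (\<lambda>w. \<beta> (w ! 0) (w ! 1)) (delta x)"

lemma multilin_bilin:
  assumes "bilin \<beta>"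
  shows "multilin 2 (\<lambda>w. \<beta> (w ! 0) (w ! 1))"
  unfolding multilin_def
proof (intro allI impI)
  fix u v :: "'a list" assume "length u + length v + 1 = 2"
  then consider p where "u = []" "v = [p]" | p where "u = [p]" "v = []"
    by (cases u; cases v) auto
  thus "lin (\<lambda>a. \<beta> ((u @ [a] @ v) ! 0) ((u @ [a] @ v) ! 1))"
    by cases (auto simp: bilinD[OF assms])
qed

lemma sweedler_plus:
  "sweedler (\<lambda>a b. \<beta> a b + \<gamma> a b) x = sweedler \<beta> x + sweedler \<gamma> x"
  by (simp add: sweedler_def lin_ext_def scale_right_distrib sum.distrib)

lemma sweedler_scale:
  "sweedler (\<lambda>a b. scale c (\<beta> a b)) x = scale c (sweedler \<beta> x)"
  by (simp add: sweedler_def lin_ext_def scale_sum_right mult.commute)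

lemma sweedler_zero: "sweedler (\<lambda>a b. 0) x = 0"
  by (simp add: sweedler_def lin_ext_def)

lemma sweedler_sum:
  "sweedler (\<lambda>a b. \<Sum>i\<in>A. \<beta> i a b) x = (\<Sum>i\<in>A. sweedler (\<beta> i) x)"
  by (induction A rule: infinite_finite_induct) (auto simp: sweedler_zero sweedler_plus)

lemma lin_sweedler:
  assumes "bilin \<beta>"
  shows "lin (sweedler \<beta>)"
proof -
  note m = multilin_bilin[OF assms]
  show ?thesis
    using lin_ext_tensor_eq[OF delta_add _ _ m] lin_ext_tensor_eq[OF delta_scale _ _ m]
    by (intro linI) (auto simp: sweedler_def delta_words words_add words_scale lin_ext_plus lin_ext_free_scale)
qed

lemma lin_sweedler_param:
  assumes "\<And>p q. lin (\<lambda>b. \<tau> p q b)"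
  shows "lin (\<lambda>b. sweedler (\<lambda>p q. \<tau> p q b) x)"
  using assms by (simp add: lin_def sweedler_plus sweedler_scale)

lemma lin_comp_sweedler: "lin f \<Longrightarrow> f (sweedler \<beta> x) = sweedler (\<lambda>a b. f (\<beta> a b)) x"
  by (simp add: sweedler_def lin_ext_def lin_sum lin_scale)

lemma sweedler_lin_ext:
  "lin_ext scale F (lin_ext free_scale (\<lambda>w. g (w ! 0) (w ! 1)) (delta x))
    = sweedler (\<lambda>a b. lin_ext scale F (g a b)) x"
  by (simp add: sweedler_def lin_ext_lin_ext[OF vs])

lemma lin_ext_tensor_append:
  "lin_ext scale F (tensor_append s t) = lin_ext scale (\<lambda>u. lin_ext scale (\<lambda>v. F (u @ v)) t) s"
  by (simp add: tensor_append_def lin_ext_lin_ext[OF vs] lin_ext_pure[OF vs])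

section \<open>Coassociativity and multiplicativity of the coproduct in Sweedler form\<close>

definition trilin :: "('a \<Rightarrow> 'a \<Rightarrow> 'a \<Rightarrow> 'a) \<Rightarrow> bool" where
  "trilin \<tau> \<longleftrightarrow> (\<forall>a b. lin (\<tau> a b)) \<and> (\<forall>a c. lin (\<lambda>b. \<tau> a b c)) \<and> (\<forall>b c. lin (\<lambda>a. \<tau> a b c))"

lemma trilinI:
  "(\<And>a b. lin (\<tau> a b)) \<Longrightarrow> (\<And>a c. lin (\<lambda>b. \<tau> a b c)) \<Longrightarrow> (\<And>b c. lin (\<lambda>a. \<tau> a b c)) \<Longrightarrow> trilin \<tau>"
  by (simp add: trilin_def)

lemma trilin_bilin:
  assumes "trilin \<tau>"
  shows "bilin (\<tau> a)" "bilin (\<lambda>p q. \<tau> p q b)"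
  using assms by (auto simp: trilin_def bilin_def)

lemma sweedler_assoc:
  assumes "trilin \<tau>"
  shows "sweedler (\<lambda>a b. sweedler (\<lambda>p q. \<tau> p q b) a) x
       = sweedler (\<lambda>a b. sweedler (\<lambda>p q. \<tau> a p q) b) x"
proof -
  \<comment> \<open>Encodes \<open>\<tau>\<close> as a functional on words of length 3, which can be
    applied to both sides of the coassociativity axiom.\<close>
  define F where "F w = \<tau> (w ! 0) (w ! 1) (w ! 2)" for w
  have m: "multilin 3 F"
    unfolding multilin_def
  proof (intro allI impI)
    fix u v :: "'a list" assume "length u + length v + 1 = 3"
    then consider p q where "u = []" "v = [p, q]" | p q where "u = [p]" "v = [q]"
      | p q where "u = [p, q]" "v = []"
      by (cases u; cases v; cases "tl u"; cases "tl v") auto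
    thus "lin (\<lambda>a. F (u @ [a] @ v))"
      by cases (use assms in \<open>auto simp: F_def trilin_def numeral_2_eq_2\<close>)
  qed
  have ta: "tensor_append (delta a) (pure [b]) \<in> words 3"
      "tensor_append (pure [b]) (delta a) \<in> words 3" for a b
    using words_tensor_append[OF delta_words[of a] words_pure[of "[b]" 1]]
      words_tensor_append[OF words_pure[of "[b]" 1] delta_words[of a]]
    by (simp_all add: eval_nat_numeral)
  have w: "lin_ext free_scale (\<lambda>w. tensor_append (delta (w ! 0)) (pure [w ! 1])) (delta x) \<in> words 3"
       "lin_ext free_scale (\<lambda>w. tensor_append (pure [w ! 0]) (delta (w ! 1))) (delta x) \<in> words 3"
    by (intro words_lin_ext ta)+
  have 1: "lin_ext scale F (tensor_append (delta a) (pure [b])) = sweedler (\<lambda>p q. \<tau> p q b) a" for a b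
    unfolding lin_ext_tensor_append lin_ext_pure[OF vs] sweedler_def
    by (rule lin_ext_cong) (use delta_words[of a] in
      \<open>auto simp: words_def F_def nth_append numeral_2_eq_2\<close>)
  have 2: "lin_ext scale F (tensor_append (pure [a]) (delta b)) = sweedler (\<lambda>p q. \<tau> a p q) b" for a b
    unfolding lin_ext_tensor_append lin_ext_pure[OF vs] sweedler_def
    by (simp add: F_def numeral_2_eq_2)
  show ?thesis
    using lin_ext_tensor_eq[OF coassociative w m]
    by (simp only: sweedler_lin_ext[where g = "\<lambda>a b. tensor_append (delta a) (pure [b])"]
        sweedler_lin_ext[where g = "\<lambda>a b. tensor_append (pure [a]) (delta b)"] 1 2)
qed

lemma sweedler_mult:
  assumes "bilin \<beta>"
  shows "sweedler \<beta> (x * y) = \<beta> x y + \<beta> y x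
    + sweedler (\<lambda>p q. \<beta> p (q * y)) x + sweedler (\<lambda>p q. \<beta> (p * y) q) x
    + sweedler (\<lambda>p q. \<beta> (x * p) q) y + sweedler (\<lambda>p q. \<beta> p (x * q)) y
    + sweedler (\<lambda>p q. sweedler (\<lambda>r s. \<beta> (p * r) (q * s)) y) x"
proof -
  let ?F = "\<lambda>w. \<beta> (w ! 0) (w ! 1)"
  have "sweedler \<beta> (x * y) = lin_ext scale ?F (delta (x * y))"
    by (simp add: sweedler_def)
  also have "\<dots> = lin_ext scale ?F (pure [x, y] + pure [y, x]
       + lin_ext free_scale (\<lambda>w. pure [w ! 0, w ! 1 * y]) (delta x)
       + lin_ext free_scale (\<lambda>w. pure [w ! 0 * y, w ! 1]) (delta x)
       + lin_ext free_scale (\<lambda>w. pure [x * w ! 0, w ! 1]) (delta y)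
       + lin_ext free_scale (\<lambda>w. pure [w ! 0, x * w ! 1]) (delta y)
       + lin_ext free_scale (\<lambda>w. lin_ext free_scale
           (\<lambda>v. pure [w ! 0 * v ! 0, w ! 1 * v ! 1]) (delta y)) (delta x))"
    by (rule lin_ext_tensor_eq[OF delta_mult delta_words _ multilin_bilin[OF assms]])
      (intro words_add words_lin_ext words_pure; simp)
  also have "\<dots> = \<beta> x y + \<beta> y x
    + sweedler (\<lambda>p q. \<beta> p (q * y)) x + sweedler (\<lambda>p q. \<beta> (p * y) q) x
    + sweedler (\<lambda>p q. \<beta> (x * p) q) y + sweedler (\<lambda>p q. \<beta> p (x * q)) y
    + sweedler (\<lambda>p q. sweedler (\<lambda>r s. \<beta> (p * r) (q * s)) y) x"
    by (simp add: lin_ext_plus lin_ext_lin_ext[OF vs] lin_ext_pure[OF vs] sweedler_def)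
  finally show ?thesis .
qed

lemma convolution_eq: "convolution scale delta f g x = sweedler (\<lambda>a b. f a * g b) x"
  by (simp add: convolution_def sweedler_def lin_ext_lin_ext[OF vs] lin_ext_pure[OF vs])

end

section \<open>Consequences of cocommutativity\<close>

context cocommutative_bialgebra
begin

lemma sweedler_commute:
  assumes "bilin \<beta>"
  shows "sweedler (\<lambda>a b. \<beta> b a) x = sweedler \<beta> x"
proof -
  have "lin_ext free_scale (\<lambda>w. pure [w ! 1, w ! 0]) (delta x) \<in> words 2"
    by (intro words_lin_ext words_pure) simp
  from lin_ext_tensor_eq[OF cocommutative this delta_words multilin_bilin[OF assms]]
  show ?thesis by (simp add: sweedler_def lin_ext_lin_ext[OF vs] lin_ext_pure[OF vs])
qed

text \<open>Coassociativity regroups so that the first two of the three factors come from one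
  coproduct; there cocommutativity exchanges them, and regrouping back gives the claim.\<close>

lemma sweedler_swap:
  assumes "trilin \<tau>"
  shows "sweedler (\<lambda>a b. sweedler (\<lambda>p q. \<tau> p a q) b) x
       = sweedler (\<lambda>a b. sweedler (\<lambda>p q. \<tau> a p q) b) x"
proof -
  have "trilin (\<lambda>a p q. \<tau> p a q)"
    using assms by (simp add: trilin_def)
  hence "sweedler (\<lambda>a b. sweedler (\<lambda>p q. \<tau> p a q) b) x
      = sweedler (\<lambda>a b. sweedler (\<lambda>p q. \<tau> q p b) a) x"
    by (rule sweedler_assoc[symmetric])
  also have "\<dots> = sweedler (\<lambda>a b. sweedler (\<lambda>p q. \<tau> p q b) a) x"
    by (simp add: sweedler_commute[OF trilin_bilin(2)[OF assms]])
  also have "\<dots> = sweedler (\<lambda>a b. sweedler (\<lambda>p q. \<tau> a p q) b) x"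
    by (rule sweedler_assoc[OF assms])
  finally show ?thesis .
qed

text \<open>Exchanges the two middle factors of a fourfold coproduct. Regrouping splits off the
  first factor; what remains is a swap of the first two of three factors.\<close>

lemma sweedler_interchange:
  assumes \<kappa>: "\<And>p. trilin (\<kappa> p)" "\<And>q r s. lin (\<lambda>p. \<kappa> p q r s)"
  shows "sweedler (\<lambda>a b. sweedler (\<lambda>p q. sweedler (\<lambda>r s. \<kappa> p q r s) b) a) x
       = sweedler (\<lambda>a b. sweedler (\<lambda>p q. sweedler (\<lambda>r s. \<kappa> p r q s) b) a) x"
proof -
  have 1: "trilin (\<lambda>p q b. sweedler (\<lambda>r s. \<kappa> p q r s) b)"
    using \<kappa> by (intro trilinI lin_sweedler lin_sweedler_param) (auto simp: trilin_def bilin_def)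
  have 2: "trilin (\<lambda>p q b. sweedler (\<lambda>r s. \<kappa> p r q s) b)"
    using \<kappa> by (intro trilinI lin_sweedler lin_sweedler_param) (auto simp: trilin_def bilin_def)
  have "sweedler (\<lambda>p q. sweedler (\<lambda>r s. \<kappa> a r p s) q) b
      = sweedler (\<lambda>p q. sweedler (\<lambda>r s. \<kappa> a p r s) q) b" for a b
    by (rule sweedler_swap[OF \<kappa>(1)])
  thus ?thesis
    by (simp only: sweedler_assoc[OF 1] sweedler_assoc[OF 2])
qed

section \<open>Coalgebra endomorphisms and Adams operations\<close>

text \<open>\<open>\<delta> \<circ> f = (f \<otimes> f) \<circ> \<delta>\<close>, tested only against bilinear maps into \<open>H\<close>: this is what
  composing convolution products requires, and it avoids representatives of tensors.\<close>

definition coalg_hom :: "('b \<Rightarrow> 'b) \<Rightarrow> bool" where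
  "coalg_hom f \<longleftrightarrow> lin f \<and>
     (\<forall>\<beta> x. bilin \<beta> \<longrightarrow> sweedler \<beta> (f x) = sweedler (\<lambda>a b. \<beta> (f a) (f b)) x)"

text \<open>The nonunital form \<open>(uc + f) \<star> (uc + g) - uc\<close> of the convolution of unital maps.\<close>

definition uconv :: "('b \<Rightarrow> 'b) \<Rightarrow> ('b \<Rightarrow> 'b) \<Rightarrow> 'b \<Rightarrow> 'b" where
  "uconv f g x = f x + g x + sweedler (\<lambda>a b. f a * g b) x"

lemma lin_uconv:
  assumes "lin f" "lin g"
  shows "lin (uconv f g)"
proof -
  have "lin (sweedler (\<lambda>a b. f a * g b))"
    by (intro lin_sweedler bilin_comp[OF bilin_mult] assms)
  thus ?thesis
    using assms by (simp add: lin_def uconv_def scale_right_distrib algebra_simps)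
qed

text \<open>This is where cocommutativity enters the Adams operations. Both sides expand into nine
  sums, which match in pairs once the Sweedler factors are reordered.\<close>

lemma coalg_hom_uconv:
  assumes f: "coalg_hom f" and g: "coalg_hom g"
  shows "coalg_hom (uconv f g)"
  unfolding coalg_hom_def
proof (intro conjI allI impI)
  have lf: "lin f" and lg: "lin g" using f g by (simp_all add: coalg_hom_def)
  show "lin (uconv f g)" by (rule lin_uconv[OF lf lg])
  fix \<beta> x assume \<beta>: "bilin \<beta>"
  note additive = lin_add[OF lf] lin_add[OF lg] lin_add[OF bilinD(1)[OF \<beta>]] lin_add[OF bilinD(2)[OF \<beta>]]
    lin_scale[OF lf] lin_scale[OF lg] lin_scale[OF bilinD(1)[OF \<beta>]] lin_scale[OF bilinD(2)[OF \<beta>]]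
    distrib_left distrib_right scale_mult_left scale_mult_right
  note multilin_defs = lin_def bilin_def trilin_def sweedler_plus sweedler_scale
  have fD: "sweedler \<gamma> (f y) = sweedler (\<lambda>a b. \<gamma> (f a) (f b)) y"
    and gD: "sweedler \<gamma> (g y) = sweedler (\<lambda>a b. \<gamma> (g a) (g b)) y" if "bilin \<gamma>" for \<gamma> y
    using f g that by (auto simp: coalg_hom_def)
  let ?S = sweedler
  \<comment> \<open>The coproduct of a product, with \<open>f\<close> and \<open>g\<close> already
    moved inside by their coalgebra map property.\<close>
  have mult: "?S \<beta> (f a * g b) = \<beta> (f a) (g b) + \<beta> (g b) (f a)
      + ?S (\<lambda>p q. \<beta> (f p) (f q * g b)) a + ?S (\<lambda>p q. \<beta> (f p * g b) (f q)) a
      + ?S (\<lambda>p q. \<beta> (f a * g p) (g q)) b + ?S (\<lambda>p q. \<beta> (g p) (f a * g q)) b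
      + ?S (\<lambda>p q. ?S (\<lambda>r s. \<beta> (f p * g r) (f q * g s)) b) a" for a b
  proof -
    have 1: "?S (\<lambda>r s. \<beta> (p * r) (q * s)) (g b) = ?S (\<lambda>r s. \<beta> (p * g r) (q * g s)) b" for p q
      by (rule gD) (simp add: multilin_defs additive)
    have 2: "?S (\<lambda>p q. ?S (\<lambda>r s. \<beta> (p * g r) (q * g s)) b) (f a)
        = ?S (\<lambda>p q. ?S (\<lambda>r s. \<beta> (f p * g r) (f q * g s)) b) a"
      by (rule fD) (simp add: multilin_defs additive)
    have 3: "?S (\<lambda>p q. \<beta> p (q * g b)) (f a) = ?S (\<lambda>p q. \<beta> (f p) (f q * g b)) a"
      "?S (\<lambda>p q. \<beta> (p * g b) q) (f a) = ?S (\<lambda>p q. \<beta> (f p * g b) (f q)) a"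
      by (rule fD, simp add: multilin_defs additive)+
    have 4: "?S (\<lambda>p q. \<beta> (f a * p) q) (g b) = ?S (\<lambda>p q. \<beta> (f a * g p) (g q)) b"
      "?S (\<lambda>p q. \<beta> p (f a * q)) (g b) = ?S (\<lambda>p q. \<beta> (g p) (f a * g q)) b"
      by (rule gD, simp add: multilin_defs additive)+
    show ?thesis by (simp only: sweedler_mult[OF \<beta>] 1 2 3 4)
  qed
  let ?T1 = "?S (\<lambda>a b. \<beta> (f a) (f b)) x" and ?T2 = "?S (\<lambda>a b. \<beta> (g a) (g b)) x"
    and ?T3 = "?S (\<lambda>a b. \<beta> (f a) (g b)) x" and ?T4 = "?S (\<lambda>a b. \<beta> (g a) (f b)) x"
  have "?S \<beta> (uconv f g x) = ?S \<beta> (f x) + ?S \<beta> (g x) + ?S (\<lambda>a b. ?S \<beta> (f a * g b)) x"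
    by (simp only: uconv_def lin_add[OF lin_sweedler[OF \<beta>]] lin_comp_sweedler[OF lin_sweedler[OF \<beta>]])
  also have "\<dots> = ?T1 + ?T2 + (?T3 + ?S (\<lambda>a b. \<beta> (g b) (f a)) x
      + ?S (\<lambda>a b. ?S (\<lambda>p q. \<beta> (f p) (f q * g b)) a) x + ?S (\<lambda>a b. ?S (\<lambda>p q. \<beta> (f p * g b) (f q)) a) x
      + ?S (\<lambda>a b. ?S (\<lambda>p q. \<beta> (f a * g p) (g q)) b) x + ?S (\<lambda>a b. ?S (\<lambda>p q. \<beta> (g p) (f a * g q)) b) x
      + ?S (\<lambda>a b. ?S (\<lambda>p q. ?S (\<lambda>r s. \<beta> (f p * g r) (f q * g s)) b) a) x)"
    by (simp only: mult fD[OF \<beta>] gD[OF \<beta>] sweedler_plus)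
  \<comment> \<open>Each sum is now turned into its counterpart on the other side: coassociativity
    regroups, cocommutativity reorders factors.\<close>
  also have "?S (\<lambda>a b. \<beta> (g b) (f a)) x = ?T4"
    by (rule sweedler_commute) (simp add: multilin_defs additive)
  also have "?S (\<lambda>a b. ?S (\<lambda>p q. \<beta> (f p) (f q * g b)) a) x
      = ?S (\<lambda>a b. ?S (\<lambda>p q. \<beta> (f a) (f p * g q)) b) x"
    by (rule sweedler_assoc) (simp add: multilin_defs additive)
  also have "?S (\<lambda>a b. ?S (\<lambda>p q. \<beta> (f p * g b) (f q)) a) x
      = ?S (\<lambda>a b. ?S (\<lambda>p q. \<beta> (f a * g q) (f p)) b) x"
    by (rule sweedler_assoc) (simp add: multilin_defs additive)
  also have "(\<lambda>a b. ?S (\<lambda>p q. \<beta> (f a * g q) (f p)) b) = (\<lambda>a b. ?S (\<lambda>p q. \<beta> (f a * g p) (f q)) b)"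
    by (intro ext sweedler_commute) (simp add: multilin_defs additive)
  also have "?S (\<lambda>a b. ?S (\<lambda>p q. \<beta> (f a * g p) (f q)) b) x
      = ?S (\<lambda>a b. ?S (\<lambda>p q. \<beta> (f p * g q) (f b)) a) x"
    by (rule sweedler_assoc[symmetric]) (simp add: multilin_defs additive)
  also have "?S (\<lambda>a b. ?S (\<lambda>p q. \<beta> (f a * g p) (g q)) b) x
      = ?S (\<lambda>a b. ?S (\<lambda>p q. \<beta> (f p * g q) (g b)) a) x"
    by (rule sweedler_assoc[symmetric]) (simp add: multilin_defs additive)
  also have "?S (\<lambda>a b. ?S (\<lambda>p q. \<beta> (g p) (f a * g q)) b) x
      = ?S (\<lambda>a b. ?S (\<lambda>p q. \<beta> (g a) (f p * g q)) b) x"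
    by (rule sweedler_swap) (simp add: multilin_defs additive)
  also have "?S (\<lambda>a b. ?S (\<lambda>p q. ?S (\<lambda>r s. \<beta> (f p * g r) (f q * g s)) b) a) x
      = ?S (\<lambda>a b. ?S (\<lambda>p q. ?S (\<lambda>r s. \<beta> (f p * g q) (f r * g s)) b) a) x"
    by (rule sweedler_interchange) (simp_all add: multilin_defs additive)
  finally have LHS: "?S \<beta> (uconv f g x) = ?T1 + ?T2 + (?T3 + ?T4
      + ?S (\<lambda>a b. ?S (\<lambda>p q. \<beta> (f a) (f p * g q)) b) x + ?S (\<lambda>a b. ?S (\<lambda>p q. \<beta> (f p * g q) (f b)) a) x
      + ?S (\<lambda>a b. ?S (\<lambda>p q. \<beta> (f p * g q) (g b)) a) x + ?S (\<lambda>a b. ?S (\<lambda>p q. \<beta> (g a) (f p * g q)) b) x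
      + ?S (\<lambda>a b. ?S (\<lambda>p q. ?S (\<lambda>r s. \<beta> (f p * g q) (f r * g s)) b) a) x)" .
  have left: "\<beta> (?S \<gamma> a) b = ?S (\<lambda>p q. \<beta> (\<gamma> p q) b) a" for \<gamma> a b
    by (rule lin_comp_sweedler[OF bilinD(2)[OF \<beta>]])
  have right: "\<beta> b (?S \<gamma> a) = ?S (\<lambda>p q. \<beta> b (\<gamma> p q)) a" for \<gamma> a b
    by (rule lin_comp_sweedler[OF bilinD(1)[OF \<beta>]])
  have "\<beta> (uconv f g a) (uconv f g b)
      = \<beta> (f a) (f b) + \<beta> (f a) (g b) + \<beta> (g a) (f b) + \<beta> (g a) (g b)
      + ?S (\<lambda>p q. \<beta> (f a) (f p * g q)) b + ?S (\<lambda>p q. \<beta> (g a) (f p * g q)) b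
      + ?S (\<lambda>p q. \<beta> (f p * g q) (f b)) a + ?S (\<lambda>p q. \<beta> (f p * g q) (g b)) a
      + ?S (\<lambda>p q. ?S (\<lambda>r s. \<beta> (f p * g q) (f r * g s)) b) a" for a b
    \<comment> \<open>Sums in the left argument are pulled out first, so that in the nested term the
      sum over \<open>a\<close> is the outer one, as in \<open>LHS\<close>.\<close>
    by (simp only: uconv_def left additive) (simp only: right additive ac_simps)
  thus "?S \<beta> (uconv f g x) = ?S (\<lambda>a b. \<beta> (uconv f g a) (uconv f g b)) x"
    by (simp add: LHS sweedler_plus)
qed

lemma coalg_hom_id: "coalg_hom id"
  by (simp add: coalg_hom_def lin_def)

lemma coalg_hom_zero: "coalg_hom (\<lambda>x. 0)"
  unfolding coalg_hom_def
proof (intro conjI allI impI)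
  fix \<beta> x assume \<beta>: "bilin \<beta>"
  show "sweedler \<beta> 0 = sweedler (\<lambda>a b. \<beta> 0 0) x"
    using lin_zero[OF lin_sweedler[OF \<beta>]] lin_zero[OF bilinD(1)[OF \<beta>]] by (simp add: sweedler_zero)
qed (simp add: lin_def)

lemma uconv_assoc:
  assumes f: "lin f" and g: "lin g" and h: "lin h"
  shows "uconv (uconv f g) h = uconv f (uconv g h)"
proof
  fix x
  have r: "sweedler \<gamma> a * b = sweedler (\<lambda>p q. \<gamma> p q * b) a" for \<gamma> a b
    by (rule lin_comp_sweedler[OF bilinD(2)[OF bilin_mult]])
  have l: "b * sweedler \<gamma> a = sweedler (\<lambda>p q. b * \<gamma> p q) a" for \<gamma> a b
    by (rule lin_comp_sweedler[OF bilinD(1)[OF bilin_mult]])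
  have "sweedler (\<lambda>a b. sweedler (\<lambda>p q. f p * g q * h b) a) x
      = sweedler (\<lambda>a b. sweedler (\<lambda>p q. f a * g p * h q) b) x"
    by (rule sweedler_assoc)
      (simp add: trilin_def lin_def lin_add[OF f] lin_add[OF g] lin_add[OF h] lin_scale[OF f]
        lin_scale[OF g] lin_scale[OF h] distrib_left distrib_right scale_mult_left scale_mult_right)
  thus "uconv (uconv f g) h x = uconv f (uconv g h) x"
    by (simp add: uconv_def distrib_left distrib_right r l sweedler_plus mult.assoc add_ac)
qed

text \<open>The Adams operations \<open>(uc + J)\<^sup>\<star>\<^sup>k\<close> restricted to \<open>H\<close>.\<close>

primrec adams :: "nat \<Rightarrow> 'b \<Rightarrow> 'b" where
  "adams 0 = (\<lambda>x. 0)"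
| "adams (Suc k) = uconv (adams k) id"

lemma coalg_hom_adams: "coalg_hom (adams k)"
  by (induction k) (auto intro: coalg_hom_zero coalg_hom_uconv coalg_hom_id)

lemma lin_adams: "lin (adams k)"
  using coalg_hom_adams[of k] by (simp add: coalg_hom_def)

lemma lin_id: "lin id"
  by (simp add: lin_def)

lemma uconv_zero: "uconv f (\<lambda>x. 0) = f"
  by (simp add: fun_eq_iff uconv_def sweedler_def lin_ext_def)

lemma adams_add: "uconv (adams m) (adams n) = adams (m + n)"
proof (induction n)
  case (Suc n)
  have "uconv (adams m) (uconv (adams n) id) = uconv (uconv (adams m) (adams n)) id"
    by (rule uconv_assoc[symmetric]) (rule lin_adams lin_id)+
  thus ?case using Suc by simp
qed (simp add: uconv_zero)

text \<open>Since \<open>adams n\<close> is a coalgebra map, composing with it on the right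
  distributes over convolution. Hence \<open>adams (Suc m)\<close> after \<open>adams n\<close> is
  \<open>uconv (adams (m * n)) (adams n)\<close>, and exponents add.\<close>

lemma adams_adams: "adams m (adams n x) = adams (m * n) x"
proof (induction m arbitrary: x)
  case (Suc m)
  have "adams (Suc m) (adams n x)
      = adams (m * n) x + adams n x + sweedler (\<lambda>a b. adams m a * b) (adams n x)"
    by (simp add: uconv_def Suc)
  also have "sweedler (\<lambda>a b. adams m a * b) (adams n x)
      = sweedler (\<lambda>a b. adams m (adams n a) * adams n b) x"
    using coalg_hom_adams[of n] bilin_comp[OF bilin_mult lin_adams[of m] lin_id]
    by (simp add: coalg_hom_def)
  also have "adams (m * n) x + adams n x + \<dots> = uconv (adams (m * n)) (adams n) x"
    by (simp add: uconv_def Suc)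
  finally show ?case by (simp add: adams_add add.commute)
qed simp

text \<open>The binomial theorem for the convolution power of \<open>uc + J\<close>, proved through
  Pascal's rule.\<close>

lemma adams_eq: "adams a x = (\<Sum>n\<le>a. scale (of_nat (a choose n)) (J_power scale delta n x))"
proof (induction a arbitrary: x)
  case (Suc a)
  let ?J = "J_power scale delta"
  \<comment> \<open>\<open>J_power\<close> at 0 is the zero map by convention, so convolving it with
    the identity does not give \<open>J\<close>. The separate summand \<open>x\<close> supplies this
    missing term.\<close>
  have J: "sweedler (\<lambda>p q. ?J n p * q) x = (if n = 0 then 0 else ?J (Suc n) x)" for n
    by (cases n) (simp_all add: convolution_eq sweedler_def lin_ext_def)
  have "x + sweedler (\<lambda>p q. adams a p * q) x
      = x + (\<Sum>n\<le>a. scale (of_nat (a choose n)) (sweedler (\<lambda>p q. ?J n p * q) x))"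
    by (simp add: Suc sum_distrib_right scale_mult_left sweedler_sum sweedler_scale)
  also have "\<dots> = (\<Sum>n\<le>a. scale (of_nat (a choose n)) (?J (Suc n) x))"
    by (simp add: J sum.atMost_shift)
  finally have 1: "x + sweedler (\<lambda>p q. adams a p * q) x = \<dots>" .
  have "(\<Sum>n\<le>Suc a. scale (of_nat (a choose n)) (?J n x))
      = (\<Sum>n\<le>a. scale (of_nat (a choose Suc n)) (?J (Suc n) x))"
    by (subst sum.atMost_Suc_shift) simp
  hence 2: "adams a x = (\<Sum>n\<le>a. scale (of_nat (a choose Suc n)) (?J (Suc n) x))"
    by (simp add: Suc binomial_eq_0)
  have "adams (Suc a) x = adams a x + (x + sweedler (\<lambda>p q. adams a p * q) x)"
    by (simp add: uconv_def)
  also have "\<dots> = (\<Sum>n\<le>a. scale (of_nat (Suc a choose Suc n)) (?J (Suc n) x))"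
    by (simp only: 1 2 sum.distrib[symmetric] scale_left_distrib[symmetric] of_nat_add[symmetric]
        binomial_Suc_Suc add.commute)
  also have "\<dots> = (\<Sum>n\<le>Suc a. scale (of_nat (Suc a choose n)) (?J n x))"
    by (subst sum.atMost_Suc_shift) simp
  finally show ?case .
qed simp

end

section \<open>Symmetry of the iterated coproduct\<close>

context nonunital_bialgebra
begin

definition iter_sweedler :: "nat \<Rightarrow> ('a list \<Rightarrow> 'a) \<Rightarrow> 'a \<Rightarrow> 'a" where
  "iter_sweedler n F x = lin_ext scale F (iter_delta delta n x)"

lemma iter_sweedler_cong:
  "(\<And>w. length w = n \<Longrightarrow> F w = G w) \<Longrightarrow> iter_sweedler n F x = iter_sweedler n G x"
  unfolding iter_sweedler_def
  by (rule lin_ext_cong) (use iter_delta_words[of n x] in \<open>auto simp: words_def\<close>)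

lemma iter_sweedler_1: "iter_sweedler (Suc 0) F x = F [x]"
  by (simp add: iter_sweedler_def lin_ext_pure[OF vs])

lemma iter_sweedler_Suc:
  "iter_sweedler (Suc (Suc n)) F x
    = sweedler (\<lambda>a b. iter_sweedler (Suc n) (\<lambda>u. F (u @ [b])) a) x"
  by (simp add: iter_sweedler_def sweedler_def lin_ext_lin_ext[OF vs] lin_ext_tensor_append
      lin_ext_pure[OF vs])

lemma lin_iter_sweedler_param:
  assumes "\<And>u. length u = n \<Longrightarrow> lin (\<lambda>b. F u b)"
  shows "lin (\<lambda>b. iter_sweedler n (\<lambda>u. F u b) x)"
proof -
  have "lin (\<lambda>b. F u b)" if "u \<in> Poly_Mapping.keys (iter_delta delta n x)" for u
    using iter_delta_words[of n x] assms that by (auto simp: words_def)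
  thus ?thesis
    unfolding iter_sweedler_def lin_ext_def
    by (intro linI) (auto simp: lin_add lin_scale scale_right_distrib sum.distrib scale_sum_right
        mult.commute intro!: sum.cong)
qed

lemma lin_iter_sweedler:
  assumes "multilin n F"
  shows "lin (iter_sweedler n F)"
  using assms
proof (induction n arbitrary: F rule: less_induct)
  case (less n)
  consider "n = 0" | "n = Suc 0" | m where "n = Suc (Suc m)" by (metis not0_implies_Suc)
  thus ?case
  proof cases
    case 1
    thus ?thesis by (auto simp: lin_def iter_sweedler_def lin_ext_def)
  next
    case 2
    thus ?thesis using multilin_lin[OF less.prems, of "[]" "[]"]
      by (simp add: lin_def iter_sweedler_1)
  next
    case (3 m)
    have "bilin (\<lambda>a b. iter_sweedler (Suc m) (\<lambda>u. F (u @ [b])) a)"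
    proof (rule bilinI)
      show "lin (\<lambda>b. iter_sweedler (Suc m) (\<lambda>u. F (u @ [b])) a)" for a
        using multilin_lin[OF less.prems, of _ "[]"] 3 by (intro lin_iter_sweedler_param) simp
      show "lin (\<lambda>a. iter_sweedler (Suc m) (\<lambda>u. F (u @ [b])) a)" for b
        using less 3 multilin_snoc by simp
    qed
    from lin_sweedler[OF this] show ?thesis
      by (simp add: 3 iter_sweedler_Suc lin_def)
  qed
qed

lemma J_power_iter_sweedler: "J_power scale delta n x = iter_sweedler n iter_mult x"
  by (simp add: J_power_eq iter_sweedler_def)

lemma lin_J_power: "lin (J_power scale delta n)"
  using lin_iter_sweedler[OF multilin_iter_mult] by (simp add: lin_def J_power_iter_sweedler)

lemma multilin_permute:
  assumes F: "multilin n F" and \<sigma>: "\<sigma> permutes {..<n}"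
  shows "multilin n (\<lambda>w. F (permute_list \<sigma> w))"
  unfolding multilin_def
proof (intro allI impI)
  fix u v :: "'a list" assume n: "length u + length v + 1 = n"
  obtain u' v' where uv: "\<And>a. permute_list \<sigma> (u @ [a] @ v) = u' @ [a] @ v'"
    by (rule permute_list_slot[of \<sigma> u v]) (use \<sigma> n in simp_all)
  have "length (permute_list \<sigma> (u @ [0] @ v)) = length (u' @ [0] @ v')"
    by (simp only: uv)
  hence "length u' + length v' + 1 = n" using n by simp
  from multilin_lin[OF F this] show "lin (\<lambda>a. F (permute_list \<sigma> (u @ [a] @ v)))"
    by (simp only: uv)
qed

end

lemma permute_list_adjacent:
  "length u = i \<Longrightarrow> permute_list (transpose i (Suc i)) (u @ [a, b] @ v) = u @ [b, a] @ v"
  by (rule nth_equalityI)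
    (auto simp: permute_list_def transpose_def nth_append nth_Cons' simp del: upt_Suc)

context cocommutative_bialgebra
begin

text \<open>At the last two slots the claim is cocommutativity of the second tensor factor of
  \<open>(Id \<otimes> \<delta>) \<circ> \<delta>\<close>, after regrouping by coassociativity.\<close>

lemma iter_sweedler_adjacent:
  assumes "multilin (Suc (Suc m)) F" "i \<le> m"
    and "\<And>u a b v. length u = i \<Longrightarrow> i + length v = m \<Longrightarrow> G (u @ [a, b] @ v) = F (u @ [b, a] @ v)"
  shows "iter_sweedler (Suc (Suc m)) G x = iter_sweedler (Suc (Suc m)) F x"
  using assms
proof (induction m arbitrary: F G x)
  case 0
  have "bilin (\<lambda>a b. F [a, b])"
    using multilin_lin[OF 0(1), of "[_]" "[]"] multilin_lin[OF 0(1), of "[]" "[_]"]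
    by (intro bilinI) simp_all
  from sweedler_commute[OF this] show ?case
    using 0(2) 0(3)[of "[]" "[]"] by (simp add: iter_sweedler_Suc iter_sweedler_1)
next
  case (Suc m)
  note F = Suc.prems(1) and G = Suc.prems(3)
  show ?case
  proof (cases "i \<le> m")
    \<comment> \<open>The exchanged slots both lie before the last one, so the last letter can be
      split off and the induction hypothesis applied.\<close>
    case True
    have "iter_sweedler (Suc (Suc m)) (\<lambda>u. G (u @ [b])) a
        = iter_sweedler (Suc (Suc m)) (\<lambda>u. F (u @ [b])) a" for a b
    proof (rule Suc.IH[OF multilin_snoc[OF F] True])
      fix u v :: "'b list" and a c assume "length u = i" "i + length v = m"
      with G[of u "v @ [b]" a c] show "G ((u @ [a, c] @ v) @ [b]) = F ((u @ [c, a] @ v) @ [b])"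
        by simp
    qed
    thus ?thesis by (simp add: iter_sweedler_Suc[of "Suc m"])
  next
    case False
    hence i: "i = Suc m" using Suc.prems(2) by simp
    define \<tau> where "\<tau> p q b = iter_sweedler (Suc m) (\<lambda>u. F (u @ [q, b])) p" for p q b
    have \<tau>: "trilin \<tau>"
    proof (rule trilinI)
      show "lin (\<lambda>b. \<tau> p q b)" for p q
        unfolding \<tau>_def using multilin_lin[OF F, of "_ @ [q]" "[]"]
        by (intro lin_iter_sweedler_param) simp
      show "lin (\<lambda>q. \<tau> p q b)" for p b
        unfolding \<tau>_def using multilin_lin[OF F, of _ "[b]"]
        by (intro lin_iter_sweedler_param) simp
      show "lin (\<lambda>p. \<tau> p q b)" for q b
        unfolding \<tau>_def using lin_iter_sweedler[OF multilin_snoc[OF multilin_snoc[OF F]], of q b]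
        by simp
    qed
    hence \<tau>': "trilin (\<lambda>p q b. \<tau> p b q)"
      by (simp add: trilin_def)
    have "iter_sweedler (Suc m) (\<lambda>u. G (u @ [q, b])) p = \<tau> p b q" for p q b
      unfolding \<tau>_def by (rule iter_sweedler_cong) (use G[of _ "[]"] i in simp)
    hence "iter_sweedler (Suc (Suc (Suc m))) G x
        = sweedler (\<lambda>a b. sweedler (\<lambda>p q. \<tau> p b q) a) x"
      by (simp add: iter_sweedler_Suc)
    also have "\<dots> = sweedler (\<lambda>a b. sweedler (\<lambda>p q. \<tau> a q p) b) x"
      by (rule sweedler_assoc[OF \<tau>'])
    also have "\<dots> = sweedler (\<lambda>a b. sweedler (\<lambda>p q. \<tau> a p q) b) x"
      by (simp add: sweedler_commute[OF trilin_bilin(1)[OF \<tau>]])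
    also have "\<dots> = sweedler (\<lambda>a b. sweedler (\<lambda>p q. \<tau> p q b) a) x"
      by (rule sweedler_assoc[OF \<tau>, symmetric])
    also have "\<dots> = iter_sweedler (Suc (Suc (Suc m))) F x"
      by (simp add: iter_sweedler_Suc \<tau>_def)
    finally show ?thesis .
  qed
qed

text \<open>Invariance of the iterated coproduct under \<open>\<sigma>\<close>, tested against
  multilinear maps into H instead of being stated in the tensor power.\<close>

definition delta_invariant :: "nat \<Rightarrow> (nat \<Rightarrow> nat) \<Rightarrow> bool" where
  "delta_invariant n \<sigma> \<longleftrightarrow> (\<forall>F x. multilin n F \<longrightarrow>
     iter_sweedler n (\<lambda>w. F (permute_list \<sigma> w)) x = iter_sweedler n F x)"

lemma delta_invariant_comp:
  assumes "delta_invariant n \<sigma>" "delta_invariant n \<tau>" "\<tau> permutes {..<n}"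
  shows "delta_invariant n (\<sigma> \<circ> \<tau>)"
  unfolding delta_invariant_def
proof (intro allI impI)
  fix F x assume F: "multilin n F"
  have "iter_sweedler n (\<lambda>w. F (permute_list (\<sigma> \<circ> \<tau>) w)) x
      = iter_sweedler n (\<lambda>w. F (permute_list \<tau> (permute_list \<sigma> w))) x"
    by (rule iter_sweedler_cong) (use assms(3) in \<open>simp add: permute_list_compose\<close>)
  also have "\<dots> = iter_sweedler n (\<lambda>w. F (permute_list \<tau> w)) x"
    using assms(1) multilin_permute[OF F assms(3)] unfolding delta_invariant_def by blast
  also have "\<dots> = iter_sweedler n F x"
    using assms(2) F unfolding delta_invariant_def by blast
  finally show "iter_sweedler n (\<lambda>w. F (permute_list (\<sigma> \<circ> \<tau>) w)) x = iter_sweedler n F x" .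
qed

lemma delta_invariant_adjacent:
  assumes "Suc i < n"
  shows "delta_invariant n (transpose i (Suc i))"
proof -
  obtain m where m: "n = Suc (Suc m)" "i \<le> m"
    by (rule that[of "n - 2"]) (use assms in simp_all)
  show ?thesis
    unfolding delta_invariant_def m(1)
    by (intro allI impI iter_sweedler_adjacent[OF _ m(2)]) (simp_all only: permute_list_adjacent)
qed

lemma delta_invariant_transpose:
  assumes "i < j" "j < n"
  shows "delta_invariant n (transpose i j)"
proof -
  have "Suc i + k < n \<Longrightarrow> delta_invariant n (transpose i (Suc i + k))" for k
  proof (induction k)
    case 0
    thus ?case by (simp add: delta_invariant_adjacent)
  next
    case (Suc k)
    let ?j = "Suc i + k"
    \<comment> \<open>Conjugating an adjacent transposition by a shorter one reduces every
      transposition to adjacent ones.\<close>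
    have "transpose i (Suc ?j) = transpose i ?j \<circ> transpose ?j (Suc ?j) \<circ> transpose i ?j"
      by (rule transpose_comp_triple[symmetric]) simp_all
    moreover have "transpose i ?j permutes {..<n}" "transpose ?j (Suc ?j) permutes {..<n}"
      using Suc.prems by (auto intro!: permutes_swap_id)
    moreover have "delta_invariant n (transpose i ?j)" "delta_invariant n (transpose ?j (Suc ?j))"
      using Suc delta_invariant_adjacent[of ?j n] by simp_all
    ultimately have "delta_invariant n (transpose i (Suc ?j))"
      by (simp only: delta_invariant_comp)
    thus ?case by simp
  qed
  from this[of "j - Suc i"] show ?thesis using assms by simp
qed

lemma delta_invariant:
  assumes "\<sigma> permutes {..<n}"
  shows "delta_invariant n \<sigma>"
  using assms finite_lessThan
proof (induction \<sigma> rule: permutes_induct)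
  case id
  show ?case by (simp add: delta_invariant_def)
next
  case (swap a b p)
  have "delta_invariant n (transpose a b)"
    using swap delta_invariant_transpose[of a b n] delta_invariant_transpose[of b a n]
    by (cases a b rule: linorder_cases) (auto simp: transpose_commute)
  thus ?case using swap by (intro delta_invariant_comp)
qed

text \<open>By symmetry of the iterated coproduct all \<open>n!\<close> summands of the average
  agree, so averaging has no effect and only the factor \<open>1 / fact n\<close> of
  \<open>theta\<close> remains.\<close>

lemma omega_J_power: "omega scale delta n x = scale (1 / fact n) (J_power scale delta n x)"
proof -
  have inv: "lin_ext scale (\<lambda>w. iter_mult (permute_list \<sigma> w)) (iter_delta delta n x)
      = J_power scale delta n x" if "\<sigma> permutes {..<n}" for \<sigma>
    using delta_invariant[OF that] multilin_iter_mult
    by (simp add: delta_invariant_def J_power_eq iter_sweedler_def)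
  have "lin_ext scale (\<lambda>w. scale (1 / fact n) (\<Sum>\<sigma> | \<sigma> permutes {..<n}. iter_mult (permute_list \<sigma> w)))
        (iter_delta delta n x)
      = scale (1 / fact n) (\<Sum>\<sigma> | \<sigma> permutes {..<n}.
          lin_ext scale (\<lambda>w. iter_mult (permute_list \<sigma> w)) (iter_delta delta n x))"
    unfolding lin_ext_def scale_sum_right
    by (subst sum.swap) (simp add: mult.commute)
  also have "\<dots> = scale (1 / fact n) (\<Sum>\<sigma> | \<sigma> permutes {..<n}. J_power scale delta n x)"
    by (simp add: inv)
  also have "\<dots> = J_power scale delta n x"
    by (simp add: sum_constant_scale card_permutations[of "{..<n}" n])
  finally show ?thesis
    by (simp only: omega_eq theta_def lin_ext_free_scale)
qed

end

section \<open>Stirling numbers\<close>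

lemma sum_atMost_shift_0:
  fixes f :: "nat \<Rightarrow> 'a::comm_monoid_add"
  assumes "f 0 = 0" "f (Suc n) = 0"
  shows "sum f {..n} = (\<Sum>m\<le>n. f (Suc m))"
proof -
  have "sum f {..n} = sum f {..Suc n}" using assms(2) by simp
  also have "\<dots> = (\<Sum>m\<le>n. f (Suc m))"
    by (subst sum.atMost_Suc_shift) (simp add: assms(1))
  finally show ?thesis .
qed

text \<open>Counts maps from an \<open>i\<close>-set to an \<open>n\<close>-set by the size
  \<open>m\<close> of the image. With upper limit \<open>n\<close> it has the same shape as
  \<open>adams_eq\<close>, so the two expansions can be compared.\<close>

lemma power_eq_sum_Stirling: "n ^ i = (\<Sum>m\<le>n. (n choose m) * (fact m * Stirling i m))"
proof (induction i)
  case 0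
  show ?case by (simp add: sum.atMost_shift)
next
  case (Suc i)
  have step: "n * (n choose m) = m * (n choose m) + Suc m * (n choose Suc m)" if "m \<le> n" for m
  proof -
    have "n * (n choose m) = m * (n choose m) + (n - m) * (n choose m)"
      using that by (simp add: add_mult_distrib[symmetric])
    also have "(n - m) * (n choose m) = Suc m * (n choose Suc m)"
      using binomial_absorb_comp[of n m] binomial_absorption[of m n] by simp
    finally show ?thesis .
  qed
  have "n ^ Suc i = (\<Sum>m\<le>n. n * (n choose m) * (fact m * Stirling i m))"
    by (simp add: Suc sum_distrib_left mult.assoc)
  also have "\<dots> = (\<Sum>m\<le>n. (m * (n choose m) + Suc m * (n choose Suc m)) * (fact m * Stirling i m))"
    by (intro sum.cong refl) (simp only: step atMost_iff)
  also have "\<dots> = (\<Sum>m\<le>n. m * (n choose m) * (fact m * Stirling i m))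
      + (\<Sum>m\<le>n. Suc m * (n choose Suc m) * (fact m * Stirling i m))"
    by (simp only: sum.distrib distrib_right)
  \<comment> \<open>Reindexing makes both sums run over \<open>Suc m\<close>, where the recurrence
    for \<open>Stirling (Suc i) (Suc m)\<close> joins them.\<close>
  also have "(\<Sum>m\<le>n. m * (n choose m) * (fact m * Stirling i m))
      = (\<Sum>m\<le>n. Suc m * (n choose Suc m) * (fact (Suc m) * Stirling i (Suc m)))"
    by (rule sum_atMost_shift_0) (simp_all add: binomial_eq_0)
  also have "\<dots> + (\<Sum>m\<le>n. Suc m * (n choose Suc m) * (fact m * Stirling i m))
      = (\<Sum>m\<le>n. (n choose Suc m) * (fact (Suc m) * Stirling (Suc i) (Suc m)))"
    by (simp add: sum.distrib[symmetric] algebra_simps)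
  also have "\<dots> = (\<Sum>m\<le>n. (n choose m) * (fact m * Stirling (Suc i) m))"
    by (rule sum_atMost_shift_0[symmetric]) (simp_all add: binomial_eq_0)
  finally show ?case .
qed

text \<open>The coefficient of a^i in the polynomial (a choose n): a signed Stirling number of the
  first kind divided by n!.\<close>

definition binomial_power_coeff :: "nat \<Rightarrow> nat \<Rightarrow> 'a::field_char_0" where
  "binomial_power_coeff n i = (- 1) ^ (n + i) * of_nat (stirling n i) / fact n"

text \<open>Expands the rising factorial of \<open>-a\<close>. Coefficients beyond degree
  \<open>n\<close> vanish, which allows one bound \<open>M\<close> for all \<open>n\<close>, so that
  sums over \<open>n\<close> and \<open>i\<close> can later be exchanged.\<close>

lemma binomial_eq_sum_powers:
  assumes "n \<le> M"
  shows "(of_nat (a choose n) :: 'a::field_char_0) = (\<Sum>i\<le>M. binomial_power_coeff n i * of_nat a ^ i)"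
proof -
  have "(of_nat (a choose n) :: 'a) = of_nat a gchoose n"
    by (simp add: binomial_gbinomial)
  also have "\<dots> = (- 1) ^ n * pochhammer (- of_nat a) n / fact n"
    by (rule gbinomial_pochhammer)
  also have "pochhammer (- of_nat a :: 'a) n = (\<Sum>i\<le>n. of_nat (stirling n i) * (- of_nat a) ^ i)"
    by (rule stirling_pochhammer[symmetric])
  also have "(- 1) ^ n * \<dots> / fact n = (\<Sum>i\<le>n. binomial_power_coeff n i * (of_nat a :: 'a) ^ i)"
    by (simp add: sum_distrib_left sum_divide_distrib binomial_power_coeff_def power_add
        power_minus[of "of_nat a"] mult_ac)
  also have "\<dots> = (\<Sum>i\<le>M. binomial_power_coeff n i * (of_nat a :: 'a) ^ i)"
    using assms by (intro sum.mono_neutral_left) (auto simp: binomial_power_coeff_def)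
  finally show ?thesis .
qed

text \<open>As \<open>stirling n 1\<close> is (n-1)!, the linear coefficients are those of the
  logarithm series.\<close>

lemma binomial_power_coeff_1:
  assumes "n \<ge> 1"
  shows "binomial_power_coeff n 1 = ((- 1) ^ (n + 1) / of_nat n :: 'a::field_char_0)"
proof -
  obtain m where m: "n = Suc m" using assms by (cases n) auto
  have "stirling n (Suc 0) = fact m" unfolding m by (rule stirling_Suc_n_1)
  moreover have "(fact m :: 'a) / fact n = 1 / of_nat n"
    by (simp add: m fact_Suc)
  ultimately have "of_nat (stirling n 1) / fact n = (1 / of_nat n :: 'a)"
    by simp
  thus ?thesis
    by (simp only: binomial_power_coeff_def times_divide_eq_right[symmetric]) simp
qed

section \<open>Eigenspaces of the Adams operations\<close>

context nonunital_bialgebra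
begin

text \<open>If p(a) vanishes at every natural number, so does p(2a) - 2^(M+1) p(a), which has no
  term of degree M+1. Induction kills its coefficients, hence all lower ones of p, since powers of 2
  are distinct in characteristic zero.\<close>

lemma vector_polynomial_eq_0:
  assumes "\<And>a. (\<Sum>i\<le>M. scale (of_nat a ^ i) (v i)) = 0" "i \<le> M"
  shows "v i = 0"
  using assms
proof (induction M arbitrary: v i)
  case 0
  from 0(1)[of 0] 0(2) show ?case by simp
next
  case (Suc M)
  define w where "w i = scale (2 ^ i - 2 ^ Suc M) (v i)" for i
  have "(\<Sum>i\<le>M. scale (of_nat a ^ i) (w i)) = 0" for a
  proof -
    have shift: "scale (of_nat a ^ i) (scale (2 ^ i - c) u)
        = scale (of_nat (2 * a) ^ i) u - scale c (scale (of_nat a ^ i) u)" for i c u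
      by (simp add: power_mult_distrib right_diff_distrib scale_left_diff_distrib
          scale_right_diff_distrib mult.commute)
    have "(\<Sum>i\<le>M. scale (of_nat a ^ i) (w i)) = (\<Sum>i\<le>Suc M. scale (of_nat a ^ i) (w i))"
      by (simp add: w_def)
    also have "\<dots> = (\<Sum>i\<le>Suc M. scale (of_nat (2 * a) ^ i) (v i))
        - scale (2 ^ Suc M) (\<Sum>i\<le>Suc M. scale (of_nat a ^ i) (v i))"
      unfolding scale_sum_right sum_subtractf[symmetric]
      by (simp only: w_def shift)
    also have "\<dots> = 0" by (simp only: Suc.prems(1) scale_zero_right diff_zero)
    finally show ?thesis .
  qed
  hence w: "w i = 0" if "i \<le> M" for i
    using Suc.IH that by blast
  have low: "v i = 0" if "i \<le> M" for i
  proof -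
    have "(of_nat (2 ^ i) :: 'k) \<noteq> of_nat (2 ^ Suc M)"
      unfolding of_nat_eq_iff using that by (simp del: power_Suc)
    hence "(2 ^ i - 2 ^ Suc M :: 'k) \<noteq> 0"
      by simp
    thus ?thesis using w[OF that] unfolding w_def by (simp del: power_Suc)
  qed
  \<comment> \<open>With the lower coefficients gone, the value at 1 is the top coefficient.\<close>
  have "v (Suc M) = 0"
    using Suc.prems(1)[of 1] low by simp
  thus ?case using low Suc.prems(2) by (cases "i \<le> M") (auto simp: le_Suc_eq)
qed

end

context cocommutative_bialgebra
begin

text \<open>Two expansions of n^i y in binomial coefficients are compared, by
  \<open>adams_eq\<close> and by Stirling numbers. The coefficient at m = n is 1, so induction on
  \<open>n\<close> identifies the terms.\<close>

lemma J_power_eigenvector: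
  assumes "\<And>a. adams a y = scale (of_nat a ^ i) y"
  shows "J_power scale delta n y = scale (of_nat (fact n * Stirling i n)) y"
proof (induction n rule: less_induct)
  case (less n)
  let ?J = "\<lambda>m. J_power scale delta m y" and ?S = "\<lambda>m. fact m * Stirling i m"
  have split: "(\<Sum>m\<le>n. f m) = f n + (\<Sum>m<n. f m)" for f :: "nat \<Rightarrow> 'c::comm_monoid_add"
    by (simp add: lessThan_Suc_atMost[symmetric] add.commute)
  have "?J n + (\<Sum>m<n. scale (of_nat (n choose m)) (?J m)) = scale (of_nat (n ^ i)) y"
    using adams_eq[of n y] by (simp add: assms split)
  also have "\<dots> = scale (of_nat (?S n)) y
      + (\<Sum>m<n. scale (of_nat (n choose m)) (scale (of_nat (?S m)) y))"
    unfolding power_eq_sum_Stirling split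
    by (simp only: binomial_n_n mult_1 of_nat_add of_nat_sum of_nat_mult scale_left_distrib
        scale_sum_left scale_scale)
  finally show ?case using less by simp
qed

text \<open>The coefficient of a^i in \<open>adams a x\<close>, provided that the convolution powers
  of \<open>J\<close> beyond \<open>M\<close> vanish at \<open>x\<close>.\<close>

definition adams_component :: "nat \<Rightarrow> nat \<Rightarrow> 'b \<Rightarrow> 'b" where
  "adams_component M i x = (\<Sum>n\<le>M. scale (binomial_power_coeff n i) (J_power scale delta n x))"

lemma adams_eq_sum_components:
  assumes "\<forall>n>M. J_power scale delta n x = 0"
  shows "adams a x = (\<Sum>i\<le>M. scale (of_nat a ^ i) (adams_component M i x))"
proof -
  let ?J = "J_power scale delta"
  \<comment> \<open>Neither of \<open>a\<close> and \<open>M\<close> need dominate: the binomials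
    vanish beyond \<open>a\<close>, the convolution powers beyond \<open>M\<close>.\<close>
  have "adams a x = (\<Sum>n\<le>max a M. scale (of_nat (a choose n)) (?J n x))"
    unfolding adams_eq by (rule sum.mono_neutral_left) (auto simp: binomial_eq_0)
  also have "\<dots> = (\<Sum>n\<le>M. scale (of_nat (a choose n)) (?J n x))"
    by (rule sum.mono_neutral_right) (auto simp: assms)
  also have "\<dots> = (\<Sum>n\<le>M. \<Sum>i\<le>M. scale (of_nat a ^ i) (scale (binomial_power_coeff n i) (?J n x)))"
    by (rule sum.cong)
      (simp_all add: binomial_eq_sum_powers[where M = M] scale_sum_left mult.commute)
  also have "\<dots> = (\<Sum>i\<le>M. scale (of_nat a ^ i) (adams_component M i x))"
    by (subst sum.swap) (simp add: adams_component_def scale_sum_right)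
  finally show ?thesis .
qed

text \<open>Comparing the coefficients of \<open>a\<^sup>i\<close> in \<open>adams b (adams a x) = adams (b * a) x\<close>.\<close>

lemma adams_component_eigenvector:
  assumes J: "\<forall>n>M. J_power scale delta n x = 0" and "i \<le> M"
  shows "adams b (adams_component M i x) = scale (of_nat b ^ i) (adams_component M i x)"
proof -
  let ?e = "\<lambda>i. adams_component M i x"
  have "adams b (?e i) - scale (of_nat b ^ i) (?e i) = 0"
  proof (rule vector_polynomial_eq_0[OF _ \<open>i \<le> M\<close>])
    fix a
    have "(\<Sum>i\<le>M. scale (of_nat a ^ i) (adams b (?e i) - scale (of_nat b ^ i) (?e i)))
        = adams b (\<Sum>i\<le>M. scale (of_nat a ^ i) (?e i))
          - (\<Sum>i\<le>M. scale (of_nat (b * a) ^ i) (?e i))"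
      by (simp add: lin_sum[OF lin_adams] lin_scale[OF lin_adams] scale_right_diff_distrib
          sum_subtractf power_mult_distrib mult.commute)
    also have "\<dots> = 0"
      unfolding adams_eq_sum_components[OF J, symmetric] adams_adams by simp
    finally show "(\<Sum>i\<le>M. scale (of_nat a ^ i) (adams b (?e i) - scale (of_nat b ^ i) (?e i))) = 0" .
  qed
  thus ?thesis by simp
qed

text \<open>\<open>stirling n 0\<close> vanishes for positive \<open>n\<close>, and the term at 0
  vanishes because \<open>J_power\<close> is zero there.\<close>

lemma adams_component_0: "adams_component M 0 x = 0"
  unfolding adams_component_def
proof (rule sum.neutral, rule ballI)
  fix n show "scale (binomial_power_coeff n 0) (J_power scale delta n x) = 0"
    by (cases n) (simp_all add: binomial_power_coeff_def)
qed

lemma adams_component_1: "adams_component M 1 x = eulerian_partial_sum scale delta M x"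
proof -
  have "eulerian_partial_sum scale delta M x
      = (\<Sum>n=1..M. scale (binomial_power_coeff n 1) (J_power scale delta n x))"
    unfolding eulerian_partial_sum_def by (rule sum.cong) (simp_all add: binomial_power_coeff_1[simplified])
  also have "\<dots> = adams_component M 1 x"
    unfolding adams_component_def
    by (rule sum.mono_neutral_left) (auto simp: Suc_le_eq)
  finally show ?thesis by simp
qed

section \<open>Action of the partial products on eigenvectors\<close>

lemma lin_omega: "lin (omega scale delta n)"
  using lin_J_power[of n] by (simp add: lin_def omega_J_power scale_right_distrib mult.commute)

lemma lin_universal_partial_product: "lin (universal_partial_product scale delta N)"
proof (induction N)
  case (Suc N)
  have "lin (\<lambda>x. x - omega scale delta (N + 2) x)"
    using lin_omega[of "N + 2"] by (simp add: lin_def scale_right_diff_distrib)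
  from lin_comp[OF Suc this] show ?case by (simp add: lin_def)
qed (simp add: lin_def)

lemma omega_eigenvector:
  assumes "\<And>a. adams a y = scale (of_nat a ^ i) y"
  shows "omega scale delta n y = scale (of_nat (Stirling i n)) y"
  by (simp add: omega_J_power J_power_eigenvector[OF assms])

lemma universal_partial_product_eigenvector_1:
  assumes "\<And>a. adams a y = scale (of_nat a) y"
  shows "universal_partial_product scale delta N y = y"
proof (induction N)
  case (Suc N)
  have "omega scale delta (N + 2) y = scale (of_nat (Stirling 1 (N + 2))) y"
    by (rule omega_eigenvector) (simp add: assms)
  thus ?case using Suc by simp
qed simp

text \<open>The factors act on \<open>y\<close> by scalars, and the one with index \<open>i\<close>
  acts by 1 - S(i,i) = 0. A product of \<open>N\<close> factors ends at index \<open>N + 1\<close>,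
  whence the bound on \<open>i\<close>.\<close>

lemma universal_partial_product_eigenvector:
  assumes y: "\<And>a. adams a y = scale (of_nat a ^ i) y" and "2 \<le> i" "i \<le> N + 1"
  shows "universal_partial_product scale delta N y = 0"
  using \<open>i \<le> N + 1\<close>
proof (induction N)
  case 0
  thus ?case using \<open>2 \<le> i\<close> by simp
next
  case (Suc N)
  let ?P = "universal_partial_product scale delta"
  have "?P (Suc N) y = ?P N (scale (1 - of_nat (Stirling i (N + 2))) y)"
    by (simp add: omega_eigenvector[OF y] scale_left_diff_distrib)
  also have "\<dots> = scale (1 - of_nat (Stirling i (N + 2))) (?P N y)"
    by (rule lin_scale[OF lin_universal_partial_product])
  also have "\<dots> = 0"
  proof (cases "i = N + 2")
    case True
    thus ?thesis by (simp del: Stirling.simps)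
  next
    case False
    thus ?thesis using Suc by simp
  qed
  finally show ?case .
qed

text \<open>Decomposes \<open>x = adams 1 x\<close> into eigenvectors. The product keeps the
  component of index 1 and annihilates all others up to \<open>M\<close>.\<close>

lemma universal_partial_product_eq_eulerian_partial_sum:
  assumes J: "\<forall>n>M. J_power scale delta n x = 0" and "M \<ge> 1"
  shows "universal_partial_product scale delta M x = eulerian_partial_sum scale delta M x"
proof -
  let ?P = "universal_partial_product scale delta M" and ?e = "\<lambda>i. adams_component M i x"
  note eigen = adams_component_eigenvector[OF J]
  have "?P (?e i) = (if i = 1 then ?e 1 else 0)" if "i \<le> M" for i
  proof -
    consider "i = 0" | "i = 1" | "2 \<le> i" by linarith
    thus ?thesis
    proof cases
      case 1
      thus ?thesis by (simp add: adams_component_0 lin_zero[OF lin_universal_partial_product])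
    next
      case 2
      thus ?thesis using eigen[of 1] that
        by (auto intro!: universal_partial_product_eigenvector_1)
    next
      case 3
      have "?P (?e i) = 0"
        by (rule universal_partial_product_eigenvector[OF eigen[OF that] 3]) (use that in simp_all)
      thus ?thesis using 3 by simp
    qed
  qed
  hence "(\<Sum>i\<le>M. ?P (?e i)) = (\<Sum>i\<le>M. if i = 1 then ?e 1 else 0)"
    by simp
  \<comment> \<open>\<open>M \<ge> 1\<close> ensures that index 1 belongs to the range of
    summation.\<close>
  also have "\<dots> = ?e 1" using \<open>M \<ge> 1\<close> by simp
  also have "(\<Sum>i\<le>M. ?P (?e i)) = ?P (adams 1 x)"
    by (simp only: adams_eq_sum_components[OF J] lin_sum[OF lin_universal_partial_product]
        of_nat_1 power_one scale_one)
  also have "adams 1 x = x"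
    by (simp add: uconv_def sweedler_zero)
  finally show ?thesis by (simp only: adams_component_1)
qed

end

theorem proposition4p1p5:
  fixes scale :: "'k::field_char_0 \<Rightarrow> 'a::ring \<Rightarrow> 'a"
    and delta :: "'a \<Rightarrow> 'a list \<Rightarrow>\<^sub>0 'k"
  assumes "connected_cocommutative_bialgebra scale delta"
  shows "universal_idempotent scale delta = eulerian_idempotent scale delta"
proof
  fix x
  interpret connected_cocommutative_bialgebra scale delta by fact
  obtain K where "\<And>n. n \<ge> K \<Longrightarrow> J_power scale delta n x = 0"
    using connected J_power_eq_0 by blast
  \<comment> \<open>The threshold \<open>Suc K\<close> makes \<open>N\<close> positive as well as at
    least \<open>K\<close>.\<close>
  hence "\<forall>\<^sub>F N in sequentially.
      universal_partial_product scale delta N x = eulerian_partial_sum scale delta N x"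
    unfolding eventually_sequentially
    by (intro exI[of _ "Suc K"] allI impI universal_partial_product_eq_eulerian_partial_sum) simp_all
  moreover note universal_idempotent_well_defined[of x]
  moreover note eulerian_idempotent_well_defined[of x]
  ultimately have "\<forall>\<^sub>F N in sequentially.
      universal_idempotent scale delta x = eulerian_idempotent scale delta x"
    by eventually_elim simp
  thus "universal_idempotent scale delta x = eulerian_idempotent scale delta x" by simp
qed

end
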